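(* Consider the infinite-horizon setting described in the context; in particular, $w$ and the $\varepsilon_k$ are Gaussian, and the $x_k$ are identically distributed, with bounded support and common positive-definite covariance matrix $\overline Q$. Then updating functions that solve Problem $\mathrm{OLL}_\gamma^\infty$ (i.e., minimize the average learning functional $J_\gamma^\infty$) are given, for $k=0,1,\dots$, by $$u_k^\circ(\tilde I_k)=L\,\mathbb{E}\{e_k^\circ\,|\,\tilde I_k\},\qquad L:=-(\overline K+\gamma I)^{-1}\overline K,$$ where $\overline K$ is the stationary solution of the average Riccati equation (defined in the context) and $e_k^\circ$ is the error vector $e_k$ when these updating functions are applied.
   Context: A prime denotes transpose, $I$ is the $d\times d$ identity matrix, and $\gamma>0$. Data model: $w\in\mathbb{R}^d$ is a random vector, $x_k\in\mathbb{R}^d$ and $\varepsilon_k\in\mathbb{R}$ ($k=0,1,\dots$) are random inputs and noises; the random variables $w,\{x_k\},\{\varepsilon_k\}$ are mutually independent and have mean $0$; $w$ has covariance matrix $\Sigma_w$ and the $\varepsilon_k$ have the same variance $\sigma_\varepsilon^2>0$; $w$ and the $\varepsilon_k$ are Gaussian; the $x_k$ are identically distributed, their common probability distribution has bounded support, and $\mathbb{E}\{x_kx_k'\}=\overline Q$ is positive-definite. The outputs are $y_k=w'x_k+\varepsilon_k$. Put $C_k:=x_k'$ and $Q_k:=x_kx_k'$. Learning machine: $\hat w_0:=0$, $\hat w_{k+1}=\hat w_k+u_k$, where the update $u_k\in\mathbb{R}^d$ is a function $u_k(I_k)$ (updating function) of $I_k:=\{(x_j,y_j),\ j=0,\dots,k;\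 u_j,\ j=0,\dots,k-1\}$ ($I_0:=\{(x_0,y_0)\}$). Error: $e_k:=\hat w_k-w$, so $e_0=-w$, $e_{k+1}=e_k+u_k$. Put $\tilde y_k:=\hat w_k'x_k-y_k$ and $\tilde I_k:=\{(x_j,\tilde y_j),\ j=0,\dots,k;\ u_j,\ j=0,\dots,k-1\}$; $I_k$ and $\tilde I_k$ are in one-to-one correspondence, so updating functions may be written as $u_k(\tilde I_k)$. Average learning functional: $$J_\gamma^\infty(\{u_k(\tilde I_k)\}_{k=0}^\infty):=\liminf_{N\to+\infty}\frac1N\,\mathbb{E}\Big\{\sum_{k=0}^{N-1}\big[e_k'Q_ke_k+\gamma u_k'u_k\big]\Big\}.$$ Problem $\mathrm{OLL}_\gamma^\infty$: find the infinite sequence of updating functions $u_0^\circ,u_1^\circ,\dots$ minimizing $J_\gamma^\infty$. Stationary solution: $\overline K$ is the symmetric positive-semidefinite matrix satisfying $\overline K=\overline K-\overline K(\overline K+\gamma I)^{-1}\overline K+\overline Q$; it is the limit, for any symmetric positive-semidefinite $P_0$, of the iteration $P_{t+1}=P_t-P_t(P_t+\gamma I)^{-1}P_t+\overline Q$. *)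

theory Defs
  imports "HOL-Probability.Probability"
begin

definition outer :: "real^'d \<Rightarrow> real^'d \<Rightarrow> real^'d^'d" where
  "outer a b = (\<chi> i j. a $ i * b $ j)"

definition pos_semidef :: "real^'d^'d \<Rightarrow> bool" where
  "pos_semidef A \<longleftrightarrow> transpose A = A \<and> (\<forall>v. 0 \<le> v \<bullet> (A *v v))"

definition pos_def :: "real^'d^'d \<Rightarrow> bool" where
  "pos_def A \<longleftrightarrow> transpose A = A \<and> (\<forall>v. v \<noteq> 0 \<longrightarrow> 0 < v \<bullet> (A *v v))"

definition stationary_riccati :: "real \<Rightarrow> real^'d^'d \<Rightarrow> real^'d^'d \<Rightarrow> bool" where
  "stationary_riccati \<gamma> Q K \<longleftrightarrow>
     pos_semidef K \<and> K = K - K ** matrix_inv (K + \<gamma> *\<^sub>R mat 1) ** K + Q"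

definition gain :: "real \<Rightarrow> real^'d^'d \<Rightarrow> real^'d^'d" where
  "gain \<gamma> K = - (matrix_inv (K + \<gamma> *\<^sub>R mat 1) ** K)"

definition covariance_matrix :: "'a measure \<Rightarrow> ('a \<Rightarrow> real^'d) \<Rightarrow> real^'d^'d" where
  "covariance_matrix M X =
     (LINT \<omega>|M. outer (X \<omega> - (LINT \<omega>'|M. X \<omega>')) (X \<omega> - (LINT \<omega>'|M. X \<omega>')))"

text \<open>
  Every linear functional of a Gaussian vector is univariate normal; the normal distribution
  with variance zero (a constant) is included, so that the covariance matrix may be singular.
\<close>

definition gaussian :: "'a measure \<Rightarrow> ('a \<Rightarrow> 'b::euclidean_space) \<Rightarrow> bool" where
  "gaussian M X \<longleftrightarrow> X \<in> borel_measurable M \<and>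
     (\<forall>a. (\<exists>c. AE \<omega> in M. a \<bullet> X \<omega> = c) \<or>
          (\<exists>\<mu> \<sigma>. 0 < \<sigma> \<and>
             distributed M lborel (\<lambda>\<omega>. a \<bullet> X \<omega>) (\<lambda>t. ennreal (normal_density \<mu> \<sigma> t))))"

definition vec_cond_exp ::
  "'a measure \<Rightarrow> 'a measure \<Rightarrow> ('a \<Rightarrow> real^'d) \<Rightarrow> 'a \<Rightarrow> real^'d" where
  "vec_cond_exp M F X \<omega> = (\<chi> i. real_cond_exp M F (\<lambda>\<omega>'. X \<omega>' $ i) \<omega>)"

text \<open>
  \<open>indep_vars\<close> needs one common codomain, but the sources here are vectors and scalars;
  hence mutual independence is expressed for the generated families of events.
\<close>

datatype source = Weight | Input nat | Noise nat

fun source_events ::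
  "'a measure \<Rightarrow> ('a \<Rightarrow> real^'d) \<Rightarrow> (nat \<Rightarrow> 'a \<Rightarrow> real^'d) \<Rightarrow> (nat \<Rightarrow> 'a \<Rightarrow> real)
    \<Rightarrow> source \<Rightarrow> 'a set set" where
  "source_events M w x \<epsilon> Weight = {w -` A \<inter> space M | A. A \<in> sets borel}"
| "source_events M w x \<epsilon> (Input k) = {x k -` A \<inter> space M | A. A \<in> sets borel}"
| "source_events M w x \<epsilon> (Noise k) = {\<epsilon> k -` A \<inter> space M | A. A \<in> sets borel}"

definition mutually_independent ::
  "'a measure \<Rightarrow> ('a \<Rightarrow> real^'d) \<Rightarrow> (nat \<Rightarrow> 'a \<Rightarrow> real^'d) \<Rightarrow> (nat \<Rightarrow> 'a \<Rightarrow> real) \<Rightarrow> bool" where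
  "mutually_independent M w x \<epsilon> \<longleftrightarrow> prob_space.indep_sets M (source_events M w x \<epsilon>) UNIV"

text \<open>
  The information available at time \<open>k\<close> is the pair of the finite sequences
  \<open>(x j, estimate j \<bullet> x j - y j)\<close> for \<open>j \<le> k\<close> and \<open>u j\<close> for \<open>j < k\<close>, both extended by \<open>undefined\<close>
  outside their index sets, as in the product measure spaces below.
\<close>

type_synonym 'd info = "(nat \<Rightarrow> (real^'d) \<times> real) \<times> (nat \<Rightarrow> real^'d)"
type_synonym 'd updating = "nat \<Rightarrow> 'd info \<Rightarrow> real^'d"

definition info_space :: "nat \<Rightarrow> ('d::finite) info measure" where
  "info_space k = PiM {..k} (\<lambda>_. borel) \<Otimes>\<^sub>M PiM {..<k} (\<lambda>_. borel)"

definition updating_functions :: "('d::finite) updating \<Rightarrow> bool" where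
  "updating_functions \<phi> \<longleftrightarrow> (\<forall>k. \<phi> k \<in> borel_measurable (info_space k))"

lemma restrict_fundef_cong [fundef_cong]:
  "I = J \<Longrightarrow> (\<And>i. i \<in> J \<Longrightarrow> f i = g i) \<Longrightarrow> restrict f I = restrict g J"
  by (auto simp: restrict_def fun_eq_iff)

function
  estimate :: "('d::finite) updating \<Rightarrow> (nat \<Rightarrow> real^'d) \<Rightarrow> (nat \<Rightarrow> real) \<Rightarrow> nat \<Rightarrow> real^'d" and
  info :: "('d::finite) updating \<Rightarrow> (nat \<Rightarrow> real^'d) \<Rightarrow> (nat \<Rightarrow> real) \<Rightarrow> nat \<Rightarrow> 'd info" and
  upd :: "('d::finite) updating \<Rightarrow> (nat \<Rightarrow> real^'d) \<Rightarrow> (nat \<Rightarrow> real) \<Rightarrow> nat \<Rightarrow> real^'d" where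
  "estimate \<phi> xs ys 0 = 0"
| "estimate \<phi> xs ys (Suc k) = estimate \<phi> xs ys k + upd \<phi> xs ys k"
| "info \<phi> xs ys k =
     (\<lambda>j\<in>{..k}. (xs j, estimate \<phi> xs ys j \<bullet> xs j - ys j), \<lambda>j\<in>{..<k}. upd \<phi> xs ys j)"
| "upd \<phi> xs ys k = \<phi> k (info \<phi> xs ys k)"
  by pat_completeness auto
termination
  by (relation "Wellfounded.measure (\<lambda>p. case p of
        Inl (_, _, _, k) \<Rightarrow> 3 * k
      | Inr (Inl (_, _, _, k)) \<Rightarrow> 3 * k + 1
      | Inr (Inr (_, _, _, k)) \<Rightarrow> 3 * k + 2)") auto

text \<open>Unfolding under the binder of \<open>restrict\<close> does not terminate.\<close>

declare info.simps [simp del] upd.simps [simp del]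

definition outputs ::
  "('a \<Rightarrow> real^'d) \<Rightarrow> (nat \<Rightarrow> 'a \<Rightarrow> real^'d) \<Rightarrow> (nat \<Rightarrow> 'a \<Rightarrow> real) \<Rightarrow> nat \<Rightarrow> 'a \<Rightarrow> real" where
  "outputs w x \<epsilon> k \<omega> = w \<omega> \<bullet> x k \<omega> + \<epsilon> k \<omega>"

definition err ::
  "('d::finite) updating \<Rightarrow> ('a \<Rightarrow> real^'d) \<Rightarrow> (nat \<Rightarrow> 'a \<Rightarrow> real^'d) \<Rightarrow> (nat \<Rightarrow> 'a \<Rightarrow> real)
    \<Rightarrow> nat \<Rightarrow> 'a \<Rightarrow> real^'d" where
  "err \<phi> w x \<epsilon> k \<omega> = estimate \<phi> (\<lambda>j. x j \<omega>) (\<lambda>j. outputs w x \<epsilon> j \<omega>) k - w \<omega>"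

definition information ::
  "('d::finite) updating \<Rightarrow> ('a \<Rightarrow> real^'d) \<Rightarrow> (nat \<Rightarrow> 'a \<Rightarrow> real^'d) \<Rightarrow> (nat \<Rightarrow> 'a \<Rightarrow> real)
    \<Rightarrow> nat \<Rightarrow> 'a \<Rightarrow> 'd info" where
  "information \<phi> w x \<epsilon> k \<omega> = info \<phi> (\<lambda>j. x j \<omega>) (\<lambda>j. outputs w x \<epsilon> j \<omega>) k"

definition update ::
  "('d::finite) updating \<Rightarrow> ('a \<Rightarrow> real^'d) \<Rightarrow> (nat \<Rightarrow> 'a \<Rightarrow> real^'d) \<Rightarrow> (nat \<Rightarrow> 'a \<Rightarrow> real)
    \<Rightarrow> nat \<Rightarrow> 'a \<Rightarrow> real^'d" where
  "update \<phi> w x \<epsilon> k \<omega> = \<phi> k (information \<phi> w x \<epsilon> k \<omega>)"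

definition information_algebra ::
  "'a measure \<Rightarrow> ('d::finite) updating \<Rightarrow> ('a \<Rightarrow> real^'d) \<Rightarrow> (nat \<Rightarrow> 'a \<Rightarrow> real^'d)
    \<Rightarrow> (nat \<Rightarrow> 'a \<Rightarrow> real) \<Rightarrow> nat \<Rightarrow> 'a measure" where
  "information_algebra M \<phi> w x \<epsilon> k =
     vimage_algebra (space M) (information \<phi> w x \<epsilon> k) (info_space k)"

text \<open>
  The summands are nonnegative for \<open>\<gamma> \<ge> 0\<close>, so the expectation is a nonnegative integral,
  possibly infinite; no integrability is imposed on the competing updating functions.
\<close>

definition learning_functional ::
  "'a measure \<Rightarrow> ('a \<Rightarrow> real^'d) \<Rightarrow> (nat \<Rightarrow> 'a \<Rightarrow> real^'d) \<Rightarrow> (nat \<Rightarrow> 'a \<Rightarrow> real) \<Rightarrow> real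
    \<Rightarrow> ('d::finite) updating \<Rightarrow> ennreal" where
  "learning_functional M w x \<epsilon> \<gamma> \<phi> =
     liminf (\<lambda>N. ennreal (1 / real N) *
       (\<integral>\<^sup>+ \<omega>. ennreal (\<Sum>k<N.
            err \<phi> w x \<epsilon> k \<omega> \<bullet> (outer (x k \<omega>) (x k \<omega>) *v err \<phi> w x \<epsilon> k \<omega>)
            + \<gamma> * (update \<phi> w x \<epsilon> k \<omega> \<bullet> update \<phi> w x \<epsilon> k \<omega>)) \<partial>M))"

text \<open>
  Both sides of the feedback law refer to the closed loop formed with \<open>\<phi>\<close> itself.
  Conditional expectations are only determined almost surely.
\<close>

definition cond_exp_feedback ::
  "'a measure \<Rightarrow> ('a \<Rightarrow> real^'d) \<Rightarrow> (nat \<Rightarrow> 'a \<Rightarrow> real^'d) \<Rightarrow> (nat \<Rightarrow> 'a \<Rightarrow> real) \<Rightarrow> real^'d^'d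
    \<Rightarrow> ('d::finite) updating \<Rightarrow> bool" where
  "cond_exp_feedback M w x \<epsilon> L \<phi> \<longleftrightarrow> (\<forall>k. AE \<omega> in M.
     \<phi> k (information \<phi> w x \<epsilon> k \<omega>) =
       L *v vec_cond_exp M (information_algebra M \<phi> w x \<epsilon> k) (err \<phi> w x \<epsilon> k) \<omega>)"

end

theory Submission
  imports Defs
begin

text \<open>
  The learning functional is nonnegative, and under the feedback law it vanishes, because the
  weight vector is learned consistently. By the Riccati equation the stage cost
  \<open>e \<bullet> Q e + \<gamma> (u \<bullet> u)\<close> equals the decrease of \<open>e \<bullet> K e\<close> plus a quadratic form in \<open>u - L e\<close>. Under
  the feedback law \<open>u - L e\<close> is \<open>L\<close> applied to the filtering error, and the conditional expectation
  minimizes the mean square of that error among all functions of the information. Comparing it with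
  an explicit estimator built from the products \<open>y j *\<^sub>R x j\<close>, whose deviations are pairwise
  uncorrelated, shows that the mean square filtering error is of order \<open>1/k\<close>. Hence the total cost
  up to time \<open>N\<close> grows at most like the harmonic numbers. Since \<open>Q\<close> is positive definite and the
  inputs are bounded, replacing \<open>x k x k'\<close> by \<open>Q\<close> costs only a constant factor.
  For existence, the updating functions are chosen recursively, each factoring a conditional
  expectation through the information.
\<close>

section \<open>Square-integrable random vectors\<close>

text \<open>Covers scalars and vectors at once through \<open>norm\<close>, so that the noises, the
  weight and the errors share the same closure lemmas.\<close>

definition square_integrable :: "'a measure \<Rightarrow> ('a \<Rightarrow> 'b::euclidean_space) \<Rightarrow> bool" where
  "square_integrable M f \<longleftrightarrow> f \<in> borel_measurable M \<and> integrable M (\<lambda>\<omega>. (norm (f \<omega>))\<^sup>2)"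

lemma square_integrable_measurable: "square_integrable M f \<Longrightarrow> f \<in> borel_measurable M"
  and square_integrable_norm: "square_integrable M f \<Longrightarrow> integrable M (\<lambda>\<omega>. (norm (f \<omega>))\<^sup>2)"
  by (auto simp: square_integrable_def)

text \<open>Almost sure domination suffices, which matters because the feedback law determines the
  updates only almost surely.\<close>

lemma square_integrable_bound:
  assumes "square_integrable M f" and "g \<in> borel_measurable M"
    and "AE \<omega> in M. norm (g \<omega>) \<le> C * norm (f \<omega>)"
  shows "square_integrable M g"
proof -
  have "integrable M (\<lambda>\<omega>. C\<^sup>2 * (norm (f \<omega>))\<^sup>2)"
    using assms(1) by (simp add: square_integrable_def)
  then have "integrable M (\<lambda>\<omega>. (norm (g \<omega>))\<^sup>2)"
  proof (rule Bochner_Integration.integrable_bound)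
    show "(\<lambda>\<omega>. (norm (g \<omega>))\<^sup>2) \<in> borel_measurable M"
      using assms(2) by measurable
    show "AE \<omega> in M. norm ((norm (g \<omega>))\<^sup>2) \<le> norm (C\<^sup>2 * (norm (f \<omega>))\<^sup>2)"
      using assms(3) by eventually_elim (simp flip: power_mult_distrib, rule power_mono, auto)
  qed
  with assms(2) show ?thesis by (simp add: square_integrable_def)
qed

lemma norm_add_square_le: "(norm (a + b))\<^sup>2 \<le> 2 * (norm a)\<^sup>2 + 2 * (norm b)\<^sup>2"
  for a b :: "'b::real_normed_vector"
proof -
  have "(norm (a + b))\<^sup>2 \<le> (norm a + norm b)\<^sup>2"
    by (simp add: norm_triangle_ineq power_mono)
  also have "\<dots> \<le> 2 * (norm a)\<^sup>2 + 2 * (norm b)\<^sup>2"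
    using sum_squares_bound[of "norm a" "norm b"] by (simp add: power2_sum)
  finally show ?thesis .
qed

lemma square_integrable_add:
  assumes "square_integrable M f" "square_integrable M g"
  shows "square_integrable M (\<lambda>\<omega>. f \<omega> + g \<omega>)"
proof -
  have [measurable]: "f \<in> borel_measurable M" "g \<in> borel_measurable M"
    using assms by (auto simp: square_integrable_def)
  have "integrable M (\<lambda>\<omega>. 2 * (norm (f \<omega>))\<^sup>2 + 2 * (norm (g \<omega>))\<^sup>2)"
    using assms by (simp add: square_integrable_def)
  then have "integrable M (\<lambda>\<omega>. (norm (f \<omega> + g \<omega>))\<^sup>2)"
    by (rule Bochner_Integration.integrable_bound) (auto intro: norm_add_square_le)
  then show ?thesis by (simp add: square_integrable_def)
qed

lemma square_integrable_uminus:
  "square_integrable M f \<Longrightarrow> square_integrable M (\<lambda>\<omega>. - f \<omega>)"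
  by (simp add: square_integrable_def)

lemma square_integrable_diff:
  assumes "square_integrable M f" "square_integrable M g"
  shows "square_integrable M (\<lambda>\<omega>. f \<omega> - g \<omega>)"
  using square_integrable_add[OF assms(1) square_integrable_uminus[OF assms(2)]] by simp

lemma square_integrable_sum:
  assumes "\<And>i. i \<in> I \<Longrightarrow> square_integrable M (f i)"
  shows "square_integrable M (\<lambda>\<omega>. \<Sum>i\<in>I. f i \<omega>)"
  using assms
proof (induction I rule: infinite_finite_induct)
  case (insert i I)
  then show ?case by (simp add: square_integrable_add)
qed (simp_all add: square_integrable_def)

lemma integrable_inner_square_integrable:
  assumes "square_integrable M f" "square_integrable M g"
  shows "integrable M (\<lambda>\<omega>. f \<omega> \<bullet> g \<omega>)"
proof -
  have [measurable]: "f \<in> borel_measurable M" "g \<in> borel_measurable M"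
    using assms by (auto simp: square_integrable_def)
  have "integrable M (\<lambda>\<omega>. (norm (f \<omega>))\<^sup>2 + (norm (g \<omega>))\<^sup>2)"
    using assms by (simp add: square_integrable_def)
  then show ?thesis
  proof (rule Bochner_Integration.integrable_bound)
    show "AE \<omega> in M. norm (f \<omega> \<bullet> g \<omega>) \<le> norm ((norm (f \<omega>))\<^sup>2 + (norm (g \<omega>))\<^sup>2)"
    proof (rule AE_I2)
      fix \<omega>
      have "\<bar>f \<omega> \<bullet> g \<omega>\<bar> \<le> norm (f \<omega>) * norm (g \<omega>)" by (rule Cauchy_Schwarz_ineq2)
      also have "\<dots> \<le> 2 * norm (f \<omega>) * norm (g \<omega>)" by simp
      also have "\<dots> \<le> (norm (f \<omega>))\<^sup>2 + (norm (g \<omega>))\<^sup>2" by (rule sum_squares_bound)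
      finally show "norm (f \<omega> \<bullet> g \<omega>) \<le> norm ((norm (f \<omega>))\<^sup>2 + (norm (g \<omega>))\<^sup>2)" by simp
    qed
  qed simp
qed

lemma integrable_mult_square_integrable:
  fixes f g :: "'a \<Rightarrow> real"
  assumes "square_integrable M f" "square_integrable M g"
  shows "integrable M (\<lambda>\<omega>. f \<omega> * g \<omega>)"
  using integrable_inner_square_integrable[OF assms] by simp

lemma (in finite_measure) square_integrable_integrable:
  fixes f :: "'a \<Rightarrow> real"
  assumes "square_integrable M f"
  shows "integrable M f"
  using integrable_mult_square_integrable[OF assms, of "\<lambda>_. 1"] by (simp add: square_integrable_def)

lemma norm_square_eq_sum_nth: "(norm v)\<^sup>2 = (\<Sum>i\<in>UNIV. (v $ i)\<^sup>2)" for v :: "real^'n"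
  unfolding power2_norm_eq_inner inner_vec_def by (simp add: power2_eq_square)

lemma measurable_vec_nth [measurable (raw)]:
  fixes f :: "'a \<Rightarrow> real^'n"
  assumes "f \<in> borel_measurable M"
  shows "(\<lambda>\<omega>. f \<omega> $ i) \<in> borel_measurable M"
  by (rule measurable_compose[OF assms borel_measurable_nth])

lemma square_integrable_nth:
  fixes f :: "'a \<Rightarrow> real^'n"
  assumes "square_integrable M f"
  shows "square_integrable M (\<lambda>\<omega>. f \<omega> $ i)"
  by (rule square_integrable_bound[OF assms, where C = 1])
     (use assms in \<open>auto simp: square_integrable_def component_le_norm_cart\<close>)

lemma borel_measurable_vecI:
  fixes f :: "'a \<Rightarrow> real^'n"
  assumes "\<And>i. (\<lambda>\<omega>. f \<omega> $ i) \<in> borel_measurable M"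
  shows "f \<in> borel_measurable M"
  by (rule borel_measurable_euclidean_space[THEN iffD2])
     (use assms in \<open>auto simp: Basis_vec_def inner_axis\<close>)

lemma square_integrable_vecI:
  fixes f :: "'a \<Rightarrow> real^'n"
  assumes "\<And>i. square_integrable M (\<lambda>\<omega>. f \<omega> $ i)"
  shows "square_integrable M f"
  unfolding square_integrable_def
proof
  show "f \<in> borel_measurable M"
    using assms by (intro borel_measurable_vecI) (simp add: square_integrable_def)
  show "integrable M (\<lambda>\<omega>. (norm (f \<omega>))\<^sup>2)"
    unfolding norm_square_eq_sum_nth
    using assms by (intro Bochner_Integration.integrable_sum) (simp add: square_integrable_def)
qed

lemma measurable_matrix_vector_mult [measurable]:
  fixes A :: "real^'n^'m"
  assumes "f \<in> borel_measurable M"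
  shows "(\<lambda>\<omega>. A *v f \<omega>) \<in> borel_measurable M"
  by (rule measurable_compose[OF assms])
     (intro borel_measurable_continuous_onI linear_continuous_on matrix_vector_mul_bounded_linear)

lemma matrix_vector_mult_bound:
  fixes A :: "real^'n^'m"
  obtains C where "C \<ge> 0" "\<And>v. norm (A *v v) \<le> C * norm v"
  using bounded_linear.nonneg_bounded[OF matrix_vector_mul_bounded_linear[of A]]
  by (auto simp: mult.commute)

lemma square_integrable_matrix_vector_mult:
  fixes A :: "real^'n^'m"
  assumes "square_integrable M f"
  shows "square_integrable M (\<lambda>\<omega>. A *v f \<omega>)"
proof -
  obtain C where "\<And>v. norm (A *v v) \<le> C * norm v"
    using matrix_vector_mult_bound[of A] by metis
  with assms show ?thesis
    by (intro square_integrable_bound[OF assms, where C = C])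
       (auto simp: square_integrable_def measurable_matrix_vector_mult)
qed

section \<open>Conditional expectation\<close>

text \<open>Cut at rational levels: \<open>g\<close> is the infimum of all rationals \<open>q\<close> whose set \<open>{f < q}\<close> is
  the preimage of a set containing the given point.\<close>

lemma real_factorization_vimage_algebra:
  fixes f :: "'a \<Rightarrow> real"
  assumes f: "f \<in> borel_measurable (vimage_algebra X h N)" and h: "h \<in> X \<rightarrow> space N"
  obtains g where "g \<in> borel_measurable N" "\<And>\<omega>. \<omega> \<in> X \<Longrightarrow> f \<omega> = g (h \<omega>)"
proof -
  have "\<exists>A\<in>sets N. {\<omega>\<in>X. f \<omega> < real_of_rat q} = h -` A \<inter> X" for q
  proof -
    have "{\<omega>\<in>X. f \<omega> < real_of_rat q} \<in> sets (vimage_algebra X h N)"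
      using measurable_sets[OF f, of "{..<real_of_rat q}"]
      by (simp add: vimage_def Int_def conj_commute)
    then show ?thesis by (auto simp: sets_vimage_algebra2[OF h])
  qed
  then obtain A where A [measurable]: "\<And>q. A q \<in> sets N"
    and A_eq: "\<And>q. {\<omega>\<in>X. f \<omega> < real_of_rat q} = h -` A q \<inter> X"
    by metis
  \<comment> \<open>Off the image of \<open>h\<close> the infimum may be infinite;
    \<open>real_of_ereal\<close> then returns 0, which keeps \<open>g\<close> real-valued and
    measurable on all of \<open>N\<close>.\<close>
  define g where "g y = real_of_ereal (INF q. if y \<in> A q then ereal (real_of_rat q) else \<infinity>)" for y
  have "g \<in> borel_measurable N"
    unfolding g_def by (measurable; simp)
  moreover have "f \<omega> = g (h \<omega>)" if "\<omega> \<in> X" for \<omega>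
  proof -
    have mem: "h \<omega> \<in> A q \<longleftrightarrow> f \<omega> < real_of_rat q" for q
      using A_eq[of q] that by blast
    have "(INF q. if h \<omega> \<in> A q then ereal (real_of_rat q) else \<infinity>) = ereal (f \<omega>)"
    proof (rule antisym)
      show "(INF q. if h \<omega> \<in> A q then ereal (real_of_rat q) else \<infinity>) \<le> ereal (f \<omega>)"
      proof (rule dense_ge)
        fix z assume "ereal (f \<omega>) < z"
        then obtain r where r: "ereal (f \<omega>) < ereal r" "ereal r < z"
          using ereal_dense2 by blast
        then obtain q where q: "f \<omega> < real_of_rat q" "real_of_rat q < r"
          using of_rat_dense by (metis less_ereal.simps(1))
        have "(INF q. if h \<omega> \<in> A q then ereal (real_of_rat q) else \<infinity>) \<le> ereal (real_of_rat q)"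
          by (rule INF_lower2[of q]) (use q mem in auto)
        also have "\<dots> \<le> z" using q r by (metis less_ereal.simps(1) less_imp_le less_trans)
        finally show "(INF q. if h \<omega> \<in> A q then ereal (real_of_rat q) else \<infinity>) \<le> z" .
      qed
      show "ereal (f \<omega>) \<le> (INF q. if h \<omega> \<in> A q then ereal (real_of_rat q) else \<infinity>)"
        by (rule INF_greatest) (auto simp: mem)
    qed
    then show ?thesis by (simp add: g_def)
  qed
  ultimately show ?thesis by (rule that)
qed

text \<open>Turns a conditional expectation given the information into a measurable function of the
  information, that is, into an admissible updating function. The scalar case is applied to each
  coordinate.\<close>

lemma vec_factorization_vimage_algebra:
  fixes f :: "'a \<Rightarrow> real^'n"
  assumes f: "f \<in> borel_measurable (vimage_algebra X h N)" and h: "h \<in> X \<rightarrow> space N"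
  obtains g where "g \<in> borel_measurable N" "\<And>\<omega>. \<omega> \<in> X \<Longrightarrow> f \<omega> = g (h \<omega>)"
proof -
  have "\<exists>g. g \<in> borel_measurable N \<and> (\<forall>\<omega>\<in>X. f \<omega> $ i = g (h \<omega>))" for i
  proof -
    have "(\<lambda>\<omega>. f \<omega> $ i) \<in> borel_measurable (vimage_algebra X h N)"
      using f by (rule measurable_vec_nth)
    from real_factorization_vimage_algebra[OF this h] show ?thesis by metis
  qed
  then obtain g where "\<And>i. g i \<in> borel_measurable N" "\<And>i \<omega>. \<omega> \<in> X \<Longrightarrow> f \<omega> $ i = g i (h \<omega>)"
    by metis
  then show ?thesis
    by (intro that[of "\<lambda>y. \<chi> i. g i y"]) (auto intro!: borel_measurable_vecI simp: vec_eq_iff)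
qed

context finite_measure_subalgebra
begin

text \<open>Conditional Jensen inequality for the convex function \<open>r\<^sup>2\<close>.\<close>

lemma square_integrable_real_cond_exp:
  fixes X :: "'a \<Rightarrow> real"
  assumes "square_integrable M X"
  shows "square_integrable M (real_cond_exp M F X)"
proof -
  have [measurable]: "X \<in> borel_measurable M"
    using assms by (simp add: square_integrable_def)
  have "integrable M (\<lambda>\<omega>. (real_cond_exp M F X \<omega>)\<^sup>2)"
  proof (rule integrable_convex_cond_exp[where I = UNIV])
    show "integrable M X" using assms by (rule square_integrable_integrable)
    show "integrable M (\<lambda>\<omega>. (X \<omega>)\<^sup>2)"
      using assms by (simp add: square_integrable_def)
    show "convex_on UNIV (\<lambda>r::real. r\<^sup>2)" by (rule convex_power2)
  qed auto
  then show ?thesis by (simp add: square_integrable_def)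
qed

text \<open>The error \<open>X - Y\<close> of the conditional expectation \<open>Y\<close> is
  orthogonal to \<open>Y - h\<close>. Expanding the square of
  \<open>X - h = (X - Y) + (Y - h)\<close> therefore leaves the mean square of \<open>X - Y\<close>
  plus a nonnegative term.\<close>

lemma real_cond_exp_best_approximation:
  fixes X h :: "'a \<Rightarrow> real"
  assumes X: "square_integrable M X" and h: "square_integrable M h" "h \<in> borel_measurable F"
  shows "(LINT \<omega>|M. (X \<omega> - real_cond_exp M F X \<omega>)\<^sup>2) \<le> (LINT \<omega>|M. (X \<omega> - h \<omega>)\<^sup>2)"
proof -
  define Y where "Y = real_cond_exp M F X"
  have Y: "square_integrable M Y"
    unfolding Y_def using X by (rule square_integrable_real_cond_exp)
  note sq = square_integrable_diff
  have cross: "(LINT \<omega>|M. (Y \<omega> - h \<omega>) * (X \<omega> - Y \<omega>)) = 0"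
  proof -
    have "(LINT \<omega>|M. (Y \<omega> - h \<omega>) * (X \<omega> - Y \<omega>))
        = (LINT \<omega>|M. (Y \<omega> - h \<omega>) * X \<omega>) - (LINT \<omega>|M. (Y \<omega> - h \<omega>) * Y \<omega>)"
      unfolding right_diff_distrib
      by (intro Bochner_Integration.integral_diff integrable_mult_square_integrable
            sq[OF Y h(1)] X Y)
    \<comment> \<open>The factor \<open>Y - h\<close> is measurable with respect to
      \<open>F\<close>, so under the integral against it \<open>Y\<close> may be exchanged for
      \<open>X\<close>.\<close>
    also have "(LINT \<omega>|M. (Y \<omega> - h \<omega>) * Y \<omega>) = (LINT \<omega>|M. (Y \<omega> - h \<omega>) * X \<omega>)"
      unfolding Y_def
      by (intro real_cond_exp_intg(2) integrable_mult_square_integrable)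
         (use X h in \<open>auto intro: sq square_integrable_real_cond_exp square_integrable_measurable\<close>)
    finally show ?thesis by simp
  qed
  have "(LINT \<omega>|M. (X \<omega> - Y \<omega>)\<^sup>2)
      = (LINT \<omega>|M. (X \<omega> - Y \<omega>)\<^sup>2) + 2 * (LINT \<omega>|M. (Y \<omega> - h \<omega>) * (X \<omega> - Y \<omega>))"
    by (simp add: cross)
  also have "\<dots> = (LINT \<omega>|M. (X \<omega> - Y \<omega>)\<^sup>2 + 2 * ((Y \<omega> - h \<omega>) * (X \<omega> - Y \<omega>)))"
    using sq[OF X Y] sq[OF Y h(1)]
    by (subst Bochner_Integration.integral_add)
       (auto intro: integrable_mult_square_integrable simp: square_integrable_def)
  also have "\<dots> \<le> (LINT \<omega>|M. (X \<omega> - h \<omega>)\<^sup>2)"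
  proof (rule integral_mono)
    show "integrable M (\<lambda>\<omega>. (X \<omega> - Y \<omega>)\<^sup>2 + 2 * ((Y \<omega> - h \<omega>) * (X \<omega> - Y \<omega>)))"
      using sq[OF X Y] sq[OF Y h(1)]
      by (intro Bochner_Integration.integrable_add integrable_mult_right)
         (auto intro: integrable_mult_square_integrable simp: square_integrable_def)
    show "integrable M (\<lambda>\<omega>. (X \<omega> - h \<omega>)\<^sup>2)"
      using sq[OF X h(1)] by (simp add: square_integrable_def)
    fix \<omega>
    have "(X \<omega> - h \<omega>)\<^sup>2 = (X \<omega> - Y \<omega>)\<^sup>2 + 2 * ((Y \<omega> - h \<omega>) * (X \<omega> - Y \<omega>)) + (Y \<omega> - h \<omega>)\<^sup>2"
      by (simp add: power2_eq_square algebra_simps)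
    then show "(X \<omega> - Y \<omega>)\<^sup>2 + 2 * ((Y \<omega> - h \<omega>) * (X \<omega> - Y \<omega>)) \<le> (X \<omega> - h \<omega>)\<^sup>2"
      by simp
  qed
  finally show ?thesis by (simp add: Y_def)
qed

lemma square_integrable_vec_cond_exp:
  assumes "square_integrable M X"
  shows "square_integrable M (vec_cond_exp M F X)"
  using assms
  by (intro square_integrable_vecI)
     (simp add: vec_cond_exp_def square_integrable_real_cond_exp square_integrable_nth)

text \<open>The squared norm is the sum of the squared coordinates and \<open>vec_cond_exp\<close>
  acts on each coordinate, so the scalar inequalities add up.\<close>

lemma vec_cond_exp_best_approximation:
  fixes X h :: "'a \<Rightarrow> real^'n"
  assumes X: "square_integrable M X" and h: "square_integrable M h" "h \<in> borel_measurable F"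
  shows "(LINT \<omega>|M. (norm (X \<omega> - vec_cond_exp M F X \<omega>))\<^sup>2) \<le> (LINT \<omega>|M. (norm (X \<omega> - h \<omega>))\<^sup>2)"
proof -
  have int: "integrable M (\<lambda>\<omega>. ((X \<omega> - Z \<omega>) $ i)\<^sup>2)" if "square_integrable M Z"
    for Z and i :: 'n
    using square_integrable_nth[OF square_integrable_diff[OF X that]]
    by (simp add: square_integrable_def)
  have "(LINT \<omega>|M. (norm (X \<omega> - vec_cond_exp M F X \<omega>))\<^sup>2)
      = (\<Sum>i\<in>UNIV. LINT \<omega>|M. ((X \<omega> - vec_cond_exp M F X \<omega>) $ i)\<^sup>2)"
    unfolding norm_square_eq_sum_nth
    by (intro Bochner_Integration.integral_sum int square_integrable_vec_cond_exp X)
  also have "\<dots> \<le> (\<Sum>i\<in>UNIV. LINT \<omega>|M. ((X \<omega> - h \<omega>) $ i)\<^sup>2)"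
    using real_cond_exp_best_approximation[OF square_integrable_nth[OF X] square_integrable_nth[OF h(1)]]
      measurable_vec_nth[OF h(2)]
    by (intro sum_mono) (simp add: vec_cond_exp_def)
  also have "\<dots> = (LINT \<omega>|M. (norm (X \<omega> - h \<omega>))\<^sup>2)"
    unfolding norm_square_eq_sum_nth
    by (intro Bochner_Integration.integral_sum[symmetric] int h)
  finally show ?thesis .
qed

end

section \<open>The stationary Riccati equation\<close>

text \<open>Positivity of the quadratic form makes the kernel trivial, hence the square matrix
  invertible. Only then is \<open>matrix_inv\<close>, which is defined by a choice operator, a
  genuine inverse.\<close>

lemma matrix_vector_mult_matrix_inv:
  fixes A :: "real^'n^'n"
  assumes "\<And>v. v \<noteq> 0 \<Longrightarrow> 0 < v \<bullet> (A *v v)"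
  shows "A *v (matrix_inv A *v v) = v" and "matrix_inv A *v (A *v v) = v"
proof -
  have "\<forall>v. A *v v = 0 \<longrightarrow> v = 0"
    using assms by (metis inner_zero_right less_irrefl)
  then have "invertible A"
    using matrix_left_invertible_ker invertible_left_inverse by blast
  then have "A ** matrix_inv A = mat 1 \<and> matrix_inv A ** A = mat 1"
    unfolding invertible_def matrix_inv_def by (rule someI_ex)
  then show "A *v (matrix_inv A *v v) = v" "matrix_inv A *v (A *v v) = v"
    by (simp_all add: matrix_vector_mul_assoc)
qed

text \<open>The quadratic form attains a minimum on the compact unit sphere; it is positive there,
  and homogeneity of degree two carries the bound to all vectors.\<close>

lemma pos_def_lower_bound:
  fixes A :: "real^'n^'n"
  assumes "pos_def A"
  obtains q where "q > 0" "\<And>v. q * (norm v)\<^sup>2 \<le> v \<bullet> (A *v v)"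
proof -
  have "continuous_on (sphere 0 1) (\<lambda>v::real^'n. v \<bullet> (A *v v))"
    by (intro continuous_intros linear_continuous_on matrix_vector_mul_bounded_linear)
  moreover obtain a :: "real^'n" where "norm a = 1"
    using vector_choose_size[of 1] by auto
  then have "sphere (0::real^'n) 1 \<noteq> {}" by auto
  ultimately obtain a :: "real^'n" where a: "norm a = 1"
    and le: "\<And>v. norm v = 1 \<Longrightarrow> a \<bullet> (A *v a) \<le> v \<bullet> (A *v v)"
    using continuous_attains_inf[of "sphere (0::real^'n) 1" "\<lambda>v. v \<bullet> (A *v v)"] by auto
  show ?thesis
  proof
    have "a \<noteq> 0" using a by auto
    then show "a \<bullet> (A *v a) > 0" using assms by (auto simp: pos_def_def)
    fix v :: "real^'n"
    show "a \<bullet> (A *v a) * (norm v)\<^sup>2 \<le> v \<bullet> (A *v v)"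
    proof (cases "v = 0")
      case False
      have "a \<bullet> (A *v a) * (norm v)\<^sup>2 \<le> (v /\<^sub>R norm v) \<bullet> (A *v (v /\<^sub>R norm v)) * (norm v)\<^sup>2"
        using False by (intro mult_right_mono le) auto
      also have "\<dots> = v \<bullet> (A *v v)"
        using False by (simp add: matrix_vector_mult_scaleR power2_eq_square field_simps)
      finally show ?thesis .
    qed simp
  qed
qed

lemma symmetric_matrix_inner_commute:
  fixes A :: "real^'n^'n"
  assumes "transpose A = A"
  shows "u \<bullet> (A *v v) = v \<bullet> (A *v u)"
  using dot_lmul_matrix[of u A v] transpose_matrix_vector[of A u] assms
  by (simp add: inner_commute)

lemma matrix_vector_mult_minus_left: "(- A) *v v = - (A *v v)" for A :: "real^'n^'m"
  by (simp add: matrix_vector_mult_def vec_eq_iff sum_negf)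

text \<open>Put \<open>A = K + \<gamma> I\<close>. The Riccati equation says that \<open>Q\<close>
  is \<open>K\<close> times the inverse of \<open>A\<close> times \<open>K\<close>, whence
  \<open>A L = - K\<close> and \<open>K L = - Q\<close>. These two relations evaluate the cross term
  and the last term of the square in \<open>u - L e\<close>. The identity is exact for arbitrary
  \<open>e\<close> and \<open>u\<close>, so it can be applied pointwise along a trajectory.\<close>

lemma riccati_completion_of_squares:
  fixes K Q :: "real^'n^'n"
  assumes "\<gamma> > 0" and "stationary_riccati \<gamma> Q K"
  shows "e \<bullet> (Q *v e) + \<gamma> * (u \<bullet> u) = e \<bullet> (K *v e) - (e + u) \<bullet> (K *v (e + u))
     + (u - gain \<gamma> K *v e) \<bullet> ((K + \<gamma> *\<^sub>R mat 1) *v (u - gain \<gamma> K *v e))"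
proof -
  define A where "A = K + \<gamma> *\<^sub>R mat 1"
  define L where "L = gain \<gamma> K"
  have sym: "transpose K = K" and nonneg: "\<And>v. 0 \<le> v \<bullet> (K *v v)"
    and Q: "Q = K ** matrix_inv A ** K"
    using assms(2) by (simp_all add: stationary_riccati_def pos_semidef_def A_def)
  have A: "A *v v = K *v v + \<gamma> *\<^sub>R v" for v
    by (simp add: A_def matrix_vector_mult_add_rdistrib scaleR_matrix_vector_assoc[symmetric])
  have pos: "0 < v \<bullet> (A *v v)" if "v \<noteq> 0" for v
    using assms(1) nonneg[of v] that by (simp add: A inner_add_right add_nonneg_pos)
  have L: "L *v v = - (matrix_inv A *v (K *v v))" for v
    by (simp add: L_def gain_def A_def matrix_vector_mult_minus_left matrix_vector_mul_assoc)
  have AL: "A *v (L *v v) = - (K *v v)" for v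
    using matrix_vector_mult_matrix_inv(1)[OF pos] by (simp add: L vec.neg)
  have KL: "K *v (L *v v) = - (Q *v v)" for v
    by (simp add: L Q vec.neg matrix_vector_mul_assoc matrix_mul_assoc)
  have K_commute: "a \<bullet> (K *v b) = b \<bullet> (K *v a)" for a b
    using sym by (rule symmetric_matrix_inner_commute)
  have Asym: "a \<bullet> (A *v b) = b \<bullet> (A *v a)" for a b
    using K_commute[of a b] by (simp add: A inner_add_right inner_commute)
  have "(u - L *v e) \<bullet> (A *v (u - L *v e))
      = u \<bullet> (A *v u) - 2 * (u \<bullet> (A *v (L *v e))) + (L *v e) \<bullet> (A *v (L *v e))"
    using Asym[of u "L *v e"]
    by (simp add: matrix_vector_mult_diff_distrib inner_diff_left inner_diff_right)
  also have "\<dots> = u \<bullet> (K *v u) + \<gamma> * (u \<bullet> u) + 2 * (u \<bullet> (K *v e)) + e \<bullet> (Q *v e)"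
    using K_commute[of "L *v e" e] unfolding AL by (simp add: KL A inner_add_right)
  finally have square: "(u - L *v e) \<bullet> (A *v (u - L *v e))
      = u \<bullet> (K *v u) + \<gamma> * (u \<bullet> u) + 2 * (u \<bullet> (K *v e)) + e \<bullet> (Q *v e)" .
  show ?thesis
    using K_commute[of e u] square unfolding L_def A_def
    by (simp add: vec.add inner_add_left inner_add_right)
qed

section \<open>Gaussian vectors are square integrable\<close>

text \<open>Writing \<open>t\<^sup>2\<close> as
  \<open>(t - \<mu>)\<^sup>2 + 2 * \<mu> * t - \<mu>\<^sup>2\<close> reduces the claim to known
  moments of the normal density.\<close>

lemma (in prob_space) integrable_square_normal:
  assumes "distributed M lborel X (\<lambda>t. ennreal (normal_density \<mu> \<sigma> t))" and "0 < \<sigma>"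
  shows "integrable M (\<lambda>\<omega>. (X \<omega>)\<^sup>2)"
proof -
  have "integrable lborel (\<lambda>t. normal_density \<mu> \<sigma> t * t\<^sup>2)"
  proof -
    have "integrable lborel (\<lambda>t. normal_density \<mu> \<sigma> t * (t - \<mu>)\<^sup>2
        + 2 * \<mu> * (normal_density \<mu> \<sigma> t * t) - \<mu>\<^sup>2 * normal_density \<mu> \<sigma> t)"
      using assms(2)
      by (intro Bochner_Integration.integrable_diff Bochner_Integration.integrable_add
            integrable_mult_right integrable_normal_moment integrable_normal_moment_nz_1
            integrable_normal_density) auto
    also have "(\<lambda>t. normal_density \<mu> \<sigma> t * (t - \<mu>)\<^sup>2
        + 2 * \<mu> * (normal_density \<mu> \<sigma> t * t) - \<mu>\<^sup>2 * normal_density \<mu> \<sigma> t)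
      = (\<lambda>t. normal_density \<mu> \<sigma> t * t\<^sup>2)"
      by (simp add: fun_eq_iff power2_eq_square algebra_simps)
    finally show ?thesis .
  qed
  then show ?thesis
    using distributed_integrable[OF assms(1), of "\<lambda>t. t\<^sup>2"] by simp
qed

text \<open>The definition of \<open>gaussian\<close>, taken at a coordinate axis, makes each
  component either almost surely constant or normal.\<close>

lemma (in prob_space) gaussian_square_integrable:
  fixes X :: "'a \<Rightarrow> real^'n"
  assumes "gaussian M X"
  shows "square_integrable M X"
proof (rule square_integrable_vecI)
  fix i
  have X [measurable]: "X \<in> borel_measurable M" using assms by (simp add: gaussian_def)
  have nth: "axis i 1 \<bullet> X \<omega> = X \<omega> $ i" for \<omega>
    by (simp add: inner_axis')
  consider c where "AE \<omega> in M. X \<omega> $ i = c"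
    | \<mu> \<sigma> where "0 < \<sigma>"
        "distributed M lborel (\<lambda>\<omega>. X \<omega> $ i) (\<lambda>t. ennreal (normal_density \<mu> \<sigma> t))"
    using assms[unfolded gaussian_def, THEN conjunct2, rule_format, of "axis i 1"]
    unfolding nth by blast
  then have "integrable M (\<lambda>\<omega>. (X \<omega> $ i)\<^sup>2)"
  proof cases
    case 1
    then show ?thesis
      by (intro integrable_const_bound[where B = "c\<^sup>2"]) (auto elim!: eventually_mono)
  next
    case 2
    then show ?thesis by (intro integrable_square_normal)
  qed
  then show "square_integrable M (\<lambda>\<omega>. X \<omega> $ i)"
    by (simp add: square_integrable_def measurable_vec_nth)
qed

section \<open>Consistency of the moment estimator\<close>

text \<open>Composing with a Borel function can only shrink the family of generated events. This
  lets independence of the sources pass to functions of the sources.\<close>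

lemma borel_preimages_compose:
  fixes f :: "'b::topological_space \<Rightarrow> 'c::topological_space"
  assumes "f \<in> borel_measurable borel"
  shows "{(\<lambda>\<omega>. f (Y \<omega>)) -` A \<inter> S | A. A \<in> sets borel} \<subseteq> {Y -` A \<inter> S | A. A \<in> sets borel}"
proof clarify
  fix A :: "'c set" assume "A \<in> sets borel"
  with assms have "f -` A \<in> sets borel" by (rule measurable_sets_borel)
  moreover have "(\<lambda>\<omega>. f (Y \<omega>)) -` A \<inter> S = Y -` (f -` A) \<inter> S" by auto
  ultimately show "\<exists>A'. (\<lambda>\<omega>. f (Y \<omega>)) -` A \<inter> S = Y -` A' \<inter> S \<and> A' \<in> sets borel"
    by blast
qed

text \<open>The moment form of the data model. The bound \<open>B\<close> is uniform in
  \<open>k\<close>, and \<open>Q\<close> is given entry by entry so that it fits scalar product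
  formulas.\<close>

locale linear_data_model = prob_space M for M :: "'a measure" +
  fixes w :: "'a \<Rightarrow> real^'d" and x :: "nat \<Rightarrow> 'a \<Rightarrow> real^'d" and \<epsilon> :: "nat \<Rightarrow> 'a \<Rightarrow> real"
    and Q :: "real^'d^'d" and \<sigma> B :: real
  assumes weight_square_integrable: "square_integrable M w"
    and input_measurable [measurable]: "x k \<in> borel_measurable M"
    and noise_square_integrable: "square_integrable M (\<epsilon> k)"
    and independent: "mutually_independent M w x \<epsilon>"
    and noise_mean: "expectation (\<epsilon> k) = 0"
    and noise_variance: "expectation (\<lambda>\<omega>. (\<epsilon> k \<omega>)\<^sup>2) = \<sigma>\<^sup>2"
    and input_bounded: "AE \<omega> in M. norm (x k \<omega>) \<le> B"
    and input_second_moment: "expectation (\<lambda>\<omega>. x k \<omega> $ a * x k \<omega> $ b) = Q $ a $ b"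
begin

lemma weight_measurable [measurable]: "w \<in> borel_measurable M"
  by (rule square_integrable_measurable[OF weight_square_integrable])

lemma noise_measurable [measurable]: "\<epsilon> k \<in> borel_measurable M"
  by (rule square_integrable_measurable[OF noise_square_integrable])

text \<open>Five factors suffice for any product of terms of two different residuals: the weight,
  two inputs and two noises. Absent factors are filled by constants.\<close>

lemma expectation_product:
  fixes f g h :: "real^'d \<Rightarrow> real" and p q :: "real \<Rightarrow> real"
  assumes "i \<noteq> j"
    and [measurable]: "f \<in> borel_measurable borel" "g \<in> borel_measurable borel"
      "h \<in> borel_measurable borel" "p \<in> borel_measurable borel" "q \<in> borel_measurable borel"
    and int: "integrable M (\<lambda>\<omega>. f (w \<omega>))" "integrable M (\<lambda>\<omega>. g (x i \<omega>))"
      "integrable M (\<lambda>\<omega>. h (x j \<omega>))" "integrable M (\<lambda>\<omega>. p (\<epsilon> i \<omega>))" "integrable M (\<lambda>\<omega>. q (\<epsilon> j \<omega>))"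
  shows "has_bochner_integral M (\<lambda>\<omega>. f (w \<omega>) * g (x i \<omega>) * h (x j \<omega>) * p (\<epsilon> i \<omega>) * q (\<epsilon> j \<omega>))
    (expectation (\<lambda>\<omega>. f (w \<omega>)) * expectation (\<lambda>\<omega>. g (x i \<omega>)) * expectation (\<lambda>\<omega>. h (x j \<omega>))
      * expectation (\<lambda>\<omega>. p (\<epsilon> i \<omega>)) * expectation (\<lambda>\<omega>. q (\<epsilon> j \<omega>)))"
proof -
  \<comment> \<open>A single family over all sources. As \<open>i\<close> and \<open>j\<close>
    differ, the case distinction yields \<open>g\<close> and \<open>p\<close> at \<open>i\<close>,
    and \<open>h\<close> and \<open>q\<close> at \<open>j\<close>; other indices are discarded by
    restricting to five sources.\<close>
  define X where "X s = (case s of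
      Weight \<Rightarrow> \<lambda>\<omega>. f (w \<omega>)
    | Input k \<Rightarrow> \<lambda>\<omega>. (if k = i then g else h) (x k \<omega>)
    | Noise k \<Rightarrow> \<lambda>\<omega>. (if k = i then p else q) (\<epsilon> k \<omega>))" for s
  have X_measurable: "X s \<in> borel_measurable M" for s
    by (cases s) (simp_all add: X_def)
  have "indep_vars (\<lambda>_. borel) X UNIV"
    unfolding indep_vars_def2
  proof (intro conjI ballI X_measurable)
    have "{X s -` A \<inter> space M | A. A \<in> sets borel} \<subseteq> source_events M w x \<epsilon> s" for s
      unfolding X_def
      by (cases s) (simp_all only: source.case source_events.simps; intro borel_preimages_compose; simp)+
    then show "indep_sets (\<lambda>s. {X s -` A \<inter> space M | A. A \<in> sets borel}) UNIV"
      using independent unfolding mutually_independent_def by (rule indep_sets_mono_sets[rotated])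
  qed
  then have indep: "indep_vars (\<lambda>_. borel) X {Weight, Input i, Input j, Noise i, Noise j}"
    by (rule indep_vars_subset) simp
  have int_X: "integrable M (X s)" if "s \<in> {Weight, Input i, Input j, Noise i, Noise j}" for s
    using that int \<open>i \<noteq> j\<close> by (auto simp: X_def)
  show ?thesis
    using indep_vars_integrable[OF _ indep int_X] indep_vars_lebesgue_integral[OF _ indep int_X] \<open>i \<noteq> j\<close>
    by (simp add: has_bochner_integral_iff X_def mult.assoc)
qed

lemma expectation_product_zero:
  fixes f g h :: "real^'d \<Rightarrow> real" and p q :: "real \<Rightarrow> real"
  assumes "i \<noteq> j"
    and "f \<in> borel_measurable borel" "g \<in> borel_measurable borel"
      "h \<in> borel_measurable borel" "p \<in> borel_measurable borel" "q \<in> borel_measurable borel"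
    and "integrable M (\<lambda>\<omega>. f (w \<omega>))" "integrable M (\<lambda>\<omega>. g (x i \<omega>))"
      "integrable M (\<lambda>\<omega>. h (x j \<omega>))" "integrable M (\<lambda>\<omega>. p (\<epsilon> i \<omega>))" "integrable M (\<lambda>\<omega>. q (\<epsilon> j \<omega>))"
    and "expectation (\<lambda>\<omega>. g (x i \<omega>)) = 0 \<or> expectation (\<lambda>\<omega>. p (\<epsilon> i \<omega>)) = 0"
  shows "has_bochner_integral M (\<lambda>\<omega>. f (w \<omega>) * g (x i \<omega>) * h (x j \<omega>) * p (\<epsilon> i \<omega>) * q (\<epsilon> j \<omega>)) 0"
  using expectation_product[OF assms(1-11)] assms(12) by auto

text \<open>The deviation of \<open>y k *\<^sub>R x k\<close> from \<open>Q *v w\<close>, which is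
  its conditional mean given the weight.\<close>

definition residual :: "nat \<Rightarrow> 'a \<Rightarrow> real^'d" where
  "residual k \<omega> = outputs w x \<epsilon> k \<omega> *\<^sub>R x k \<omega> - Q *v w \<omega>"

lemma outputs_measurable [measurable]: "outputs w x \<epsilon> k \<in> borel_measurable M"
  unfolding outputs_def by measurable

lemma residual_measurable [measurable]: "residual k \<in> borel_measurable M"
  unfolding residual_def by measurable

text \<open>Separates the sources: a centred function of the input times a weight component, plus an
  input component times the noise.\<close>

lemma residual_nth: "residual k \<omega> $ a =
    (\<Sum>b\<in>UNIV. (x k \<omega> $ a * x k \<omega> $ b - Q $ a $ b) * w \<omega> $ b) + x k \<omega> $ a * \<epsilon> k \<omega>"
  by (simp add: residual_def outputs_def matrix_vector_mult_def inner_vec_def sum_subtractf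
      sum_distrib_left sum_distrib_right algebra_simps)

lemma input_nth_bounded: "AE \<omega> in M. \<bar>x k \<omega> $ a\<bar> \<le> B"
  using input_bounded[of k] by eventually_elim (rule order_trans[OF component_le_norm_cart])

lemma integrable_input_nth: "integrable M (\<lambda>\<omega>. x k \<omega> $ a)"
  by (rule integrable_const_bound[where B = B]) (use input_nth_bounded[of k a] in auto)

lemma integrable_input_nth_mult: "integrable M (\<lambda>\<omega>. x k \<omega> $ a * x k \<omega> $ b)"
proof (rule integrable_const_bound[where B = "B * B"])
  show "AE \<omega> in M. norm (x k \<omega> $ a * x k \<omega> $ b) \<le> B * B"
    using input_nth_bounded[of k a] input_nth_bounded[of k b]
    by eventually_elim (simp add: abs_mult mult_mono')
qed measurable

text \<open>The residuals share \<open>w\<close>, so they are uncorrelated rather than independent.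
  After multiplying out, every term has a mean-zero factor of index \<open>i\<close>, either the
  centred second moment \<open>D a b (x i \<omega>)\<close> or the noise
  \<open>\<epsilon> i \<omega>\<close>, and the expectation factorizes.\<close>

lemma expectation_residual_inner:
  assumes "i \<noteq> j"
  shows "has_bochner_integral M (\<lambda>\<omega>. residual i \<omega> \<bullet> residual j \<omega>) 0"
proof -
  define D where "D a b v = v $ a * v $ b - Q $ a $ b" for a b and v :: "real^'d"
  have [measurable]: "D a b \<in> borel_measurable borel" for a b
    unfolding D_def by measurable
  have D_int: "integrable M (\<lambda>\<omega>. D a b (x k \<omega>))" for a b k
    unfolding D_def by (intro Bochner_Integration.integrable_diff integrable_input_nth_mult) simp
  have D_zero: "expectation (\<lambda>\<omega>. D a b (x k \<omega>)) = 0" for a b k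
    unfolding D_def using integrable_input_nth_mult by (simp add: input_second_moment prob_space)
  have integrable_const: "integrable M (\<lambda>_. 1::real)" by simp
  have w_int: "integrable M (\<lambda>\<omega>. w \<omega> $ b)" for b
    by (intro square_integrable_integrable square_integrable_nth weight_square_integrable)
  have ww_int: "integrable M (\<lambda>\<omega>. w \<omega> $ b * w \<omega> $ c)" for b c
    by (intro integrable_mult_square_integrable square_integrable_nth weight_square_integrable)
  have \<epsilon>_int: "integrable M (\<epsilon> k)" for k
    by (intro square_integrable_integrable noise_square_integrable)
  \<comment> \<open>\<open>T1\<close> to \<open>T4\<close> treat the four kinds of products: weight
    with weight, weight with noise, noise with weight, noise with noise.\<close>
  have T1: "has_bochner_integral M (\<lambda>\<omega>. (D a b (x i \<omega>) * w \<omega> $ b) * (D a c (x j \<omega>) * w \<omega> $ c)) 0" for a b c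
  proof -
    have "has_bochner_integral M
        (\<lambda>\<omega>. (w \<omega> $ b * w \<omega> $ c) * D a b (x i \<omega>) * D a c (x j \<omega>) * 1 * 1) 0"
      by (rule expectation_product_zero[OF assms, where f = "\<lambda>v. v $ b * v $ c" and p = "\<lambda>_. 1" and q = "\<lambda>_. 1"])
         (measurable, simp_all only: D_int D_zero ww_int integrable_const simp_thms)
    then show ?thesis by (simp only: mult_ac mult_1_right mult_1_left)
  qed
  have T2: "has_bochner_integral M (\<lambda>\<omega>. (D a b (x i \<omega>) * w \<omega> $ b) * (x j \<omega> $ a * \<epsilon> j \<omega>)) 0" for a b
  proof -
    have "has_bochner_integral M (\<lambda>\<omega>. w \<omega> $ b * D a b (x i \<omega>) * x j \<omega> $ a * 1 * \<epsilon> j \<omega>) 0"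
      by (rule expectation_product_zero[OF assms, where f = "\<lambda>v. v $ b" and h = "\<lambda>v. v $ a" and p = "\<lambda>_. 1" and q = "\<lambda>r. r"])
         (measurable, simp_all only: D_int D_zero w_int \<epsilon>_int integrable_input_nth integrable_const simp_thms)
    then show ?thesis by (simp only: mult_ac mult_1_right mult_1_left)
  qed
  have T3: "has_bochner_integral M (\<lambda>\<omega>. (x i \<omega> $ a * \<epsilon> i \<omega>) * (D a c (x j \<omega>) * w \<omega> $ c)) 0" for a c
  proof -
    have "has_bochner_integral M (\<lambda>\<omega>. w \<omega> $ c * x i \<omega> $ a * D a c (x j \<omega>) * \<epsilon> i \<omega> * 1) 0"
      by (rule expectation_product_zero[OF assms, where f = "\<lambda>v. v $ c" and g = "\<lambda>v. v $ a" and p = "\<lambda>r. r" and q = "\<lambda>_. 1"])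
         (measurable, simp_all only: D_int noise_mean w_int \<epsilon>_int integrable_input_nth integrable_const simp_thms)
    then show ?thesis by (simp only: mult_ac mult_1_right mult_1_left)
  qed
  have T4: "has_bochner_integral M (\<lambda>\<omega>. (x i \<omega> $ a * \<epsilon> i \<omega>) * (x j \<omega> $ a * \<epsilon> j \<omega>)) 0" for a
  proof -
    have "has_bochner_integral M (\<lambda>\<omega>. 1 * x i \<omega> $ a * x j \<omega> $ a * \<epsilon> i \<omega> * \<epsilon> j \<omega>) 0"
      by (rule expectation_product_zero[OF assms, where f = "\<lambda>_. 1" and g = "\<lambda>v. v $ a" and h = "\<lambda>v. v $ a" and p = "\<lambda>r. r" and q = "\<lambda>r. r"])
         (measurable, simp_all only: noise_mean \<epsilon>_int integrable_input_nth integrable_const simp_thms)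
    then show ?thesis by (simp only: mult_ac mult_1_right mult_1_left)
  qed
  have zero_add: "has_bochner_integral M (\<lambda>\<omega>. f \<omega> + g \<omega>) 0"
    if "has_bochner_integral M f 0" "has_bochner_integral M g 0" for f g :: "'a \<Rightarrow> real"
    using has_bochner_integral_add[OF that] by simp
  have zero_sum: "has_bochner_integral M (\<lambda>\<omega>. \<Sum>a\<in>UNIV. f a \<omega>) 0"
    if "\<And>a. has_bochner_integral M (f a) 0" for f :: "'d \<Rightarrow> 'a \<Rightarrow> real"
    using has_bochner_integral_sum[of UNIV M f "\<lambda>_. 0"] that by simp
  have "has_bochner_integral M (\<lambda>\<omega>. \<Sum>a\<in>UNIV.
      ((\<Sum>b\<in>UNIV. \<Sum>c\<in>UNIV. (D a b (x i \<omega>) * w \<omega> $ b) * (D a c (x j \<omega>) * w \<omega> $ c))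
      + (\<Sum>b\<in>UNIV. (D a b (x i \<omega>) * w \<omega> $ b) * (x j \<omega> $ a * \<epsilon> j \<omega>)))
      + ((\<Sum>c\<in>UNIV. (x i \<omega> $ a * \<epsilon> i \<omega>) * (D a c (x j \<omega>) * w \<omega> $ c))
      + (x i \<omega> $ a * \<epsilon> i \<omega>) * (x j \<omega> $ a * \<epsilon> j \<omega>))) 0"
    by (intro zero_sum zero_add T1 T2 T3 T4)
  moreover have "residual i \<omega> \<bullet> residual j \<omega> = (\<Sum>a\<in>UNIV.
      ((\<Sum>b\<in>UNIV. \<Sum>c\<in>UNIV. (D a b (x i \<omega>) * w \<omega> $ b) * (D a c (x j \<omega>) * w \<omega> $ c))
      + (\<Sum>b\<in>UNIV. (D a b (x i \<omega>) * w \<omega> $ b) * (x j \<omega> $ a * \<epsilon> j \<omega>)))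
      + ((\<Sum>c\<in>UNIV. (x i \<omega> $ a * \<epsilon> i \<omega>) * (D a c (x j \<omega>) * w \<omega> $ c))
      + (x i \<omega> $ a * \<epsilon> i \<omega>) * (x j \<omega> $ a * \<epsilon> j \<omega>)))" for \<omega>
  proof -
    \<comment> \<open>Used from right to left: once the sums are folded back into products, both
      sides agree by distributivity.\<close>
    have expand: "(\<Sum>b\<in>UNIV. f b) * (\<Sum>c\<in>UNIV. g c) = (\<Sum>b\<in>UNIV. \<Sum>c\<in>UNIV. f b * g c)"
      "(\<Sum>b\<in>UNIV. f b) * s = (\<Sum>b\<in>UNIV. f b * s)" "r * (\<Sum>c\<in>UNIV. g c) = (\<Sum>c\<in>UNIV. r * g c)"
      for f g :: "'d \<Rightarrow> real" and r s :: real
      by (rule sum_product, rule sum_distrib_right, rule sum_distrib_left)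
    show ?thesis
      unfolding inner_vec_def residual_nth D_def[symmetric] inner_real_def expand[symmetric]
      by (intro sum.cong refl) (simp only: distrib_left distrib_right add_ac)
  qed
  ultimately show ?thesis by simp
qed

text \<open>Bounded inputs give a pointwise bound linear in \<open>norm (w \<omega>)\<close> and the
  modulus of the noise; the second moments of these do not depend on \<open>k\<close>.\<close>

lemma residual_bound:
  obtains C where "\<And>k. square_integrable M (residual k)"
    "\<And>k. expectation (\<lambda>\<omega>. (norm (residual k \<omega>))\<^sup>2) \<le> C"
proof -
  obtain c where "c \<ge> 0" and c: "\<And>v. norm (Q *v v) \<le> c * norm v"
    using matrix_vector_mult_bound[of Q] by metis
  \<comment> \<open>The total coefficient of \<open>norm (w \<omega>)\<close>:
    \<open>B\<^sup>2\<close> from the output times the input, and \<open>c\<close> from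
    \<open>Q *v w\<close>.\<close>
  define d where "d = B\<^sup>2 + c"
  have bound: "AE \<omega> in M. (norm (residual k \<omega>))\<^sup>2
      \<le> 2 * d\<^sup>2 * (norm (w \<omega>))\<^sup>2 + 2 * B\<^sup>2 * (\<epsilon> k \<omega>)\<^sup>2" for k
    using input_bounded[of k]
  proof eventually_elim
    case (elim \<omega>)
    then have "B \<ge> 0" by (rule order_trans[OF norm_ge_zero])
    have wx: "\<bar>w \<omega> \<bullet> x k \<omega>\<bar> \<le> norm (w \<omega>) * B"
      by (rule order_trans[OF Cauchy_Schwarz_ineq2]) (use elim in \<open>simp add: mult_left_mono\<close>)
    have "norm (residual k \<omega>) \<le> \<bar>outputs w x \<epsilon> k \<omega>\<bar> * norm (x k \<omega>) + norm (Q *v w \<omega>)"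
      unfolding residual_def by (rule order_trans[OF norm_triangle_ineq4]) simp
    also have "\<dots> \<le> (norm (w \<omega>) * B + \<bar>\<epsilon> k \<omega>\<bar>) * B + c * norm (w \<omega>)"
    proof (intro add_mono mult_mono c elim)
      show "\<bar>outputs w x \<epsilon> k \<omega>\<bar> \<le> norm (w \<omega>) * B + \<bar>\<epsilon> k \<omega>\<bar>"
        using wx by (simp add: outputs_def)
    qed (use \<open>B \<ge> 0\<close> in auto)
    also have "\<dots> = d * norm (w \<omega>) + B * \<bar>\<epsilon> k \<omega>\<bar>"
      by (simp add: d_def power2_eq_square algebra_simps)
    finally have "(norm (residual k \<omega>))\<^sup>2 \<le> (d * norm (w \<omega>) + B * \<bar>\<epsilon> k \<omega>\<bar>)\<^sup>2"
      by (rule power_mono) simp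
    also have "\<dots> \<le> 2 * (d * norm (w \<omega>))\<^sup>2 + 2 * (B * \<bar>\<epsilon> k \<omega>\<bar>)\<^sup>2"
      using norm_add_square_le[of "d * norm (w \<omega>)" "B * \<bar>\<epsilon> k \<omega>\<bar>"] by simp
    finally show ?case by (simp add: power_mult_distrib)
  qed
  have int: "integrable M (\<lambda>\<omega>. 2 * d\<^sup>2 * (norm (w \<omega>))\<^sup>2 + 2 * B\<^sup>2 * (\<epsilon> k \<omega>)\<^sup>2)" for k
    using square_integrable_norm[OF weight_square_integrable]
      square_integrable_norm[OF noise_square_integrable[of k]] by simp
  have sq: "square_integrable M (residual k)" for k
    unfolding square_integrable_def
    by (intro conjI residual_measurable Bochner_Integration.integrable_bound[OF int[of k]])
       (use bound[of k] in \<open>auto elim!: eventually_mono\<close>)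
  have "expectation (\<lambda>\<omega>. (norm (residual k \<omega>))\<^sup>2)
      \<le> 2 * d\<^sup>2 * expectation (\<lambda>\<omega>. (norm (w \<omega>))\<^sup>2) + 2 * B\<^sup>2 * \<sigma>\<^sup>2" for k
  proof -
    have "expectation (\<lambda>\<omega>. (norm (residual k \<omega>))\<^sup>2)
        \<le> expectation (\<lambda>\<omega>. 2 * d\<^sup>2 * (norm (w \<omega>))\<^sup>2 + 2 * B\<^sup>2 * (\<epsilon> k \<omega>)\<^sup>2)"
      by (intro integral_mono_AE square_integrable_norm sq int bound)
    also have "\<dots> = 2 * d\<^sup>2 * expectation (\<lambda>\<omega>. (norm (w \<omega>))\<^sup>2) + 2 * B\<^sup>2 * \<sigma>\<^sup>2"
      using square_integrable_norm[OF weight_square_integrable]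
        square_integrable_norm[OF noise_square_integrable[of k]] noise_variance[of k]
      by simp
    finally show ?thesis .
  qed
  with sq show ?thesis by (rule that)
qed

text \<open>The off-diagonal terms vanish by uncorrelatedness, so the mean square grows linearly in
  \<open>n\<close> instead of quadratically.\<close>

lemma residual_sum_bound:
  obtains C where
    "\<And>n. expectation (\<lambda>\<omega>. (norm (\<Sum>k<n. residual k \<omega>))\<^sup>2) \<le> real n * C"
    "\<And>n. square_integrable M (\<lambda>\<omega>. \<Sum>k<n. residual k \<omega>)"
proof -
  obtain C where sq: "\<And>k. square_integrable M (residual k)"
    and C: "\<And>k. expectation (\<lambda>\<omega>. (norm (residual k \<omega>))\<^sup>2) \<le> C"
    using residual_bound by metis
  have "expectation (\<lambda>\<omega>. (norm (\<Sum>k<n. residual k \<omega>))\<^sup>2) \<le> real n * C" for n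
  proof -
    have "expectation (\<lambda>\<omega>. (norm (\<Sum>k<n. residual k \<omega>))\<^sup>2)
        = (\<Sum>i<n. \<Sum>j<n. expectation (\<lambda>\<omega>. residual i \<omega> \<bullet> residual j \<omega>))"
      by (simp add: power2_norm_eq_inner inner_sum_left inner_sum_right
          integrable_inner_square_integrable sq) (rule sum.swap)
    also have "\<dots> = (\<Sum>i<n. \<Sum>j<n. if i = j then expectation (\<lambda>\<omega>. (norm (residual i \<omega>))\<^sup>2) else 0)"
      using expectation_residual_inner
      by (intro sum.cong) (auto simp: power2_norm_eq_inner has_bochner_integral_iff)
    also have "\<dots> = (\<Sum>i<n. expectation (\<lambda>\<omega>. (norm (residual i \<omega>))\<^sup>2))"
      by simp
    also have "\<dots> \<le> (\<Sum>i<n. C)" by (intro sum_mono C)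
    finally show ?thesis by simp
  qed
  then show ?thesis by (rule that) (intro square_integrable_sum sq)
qed

end

section \<open>The closed loop\<close>

lemma estimate_eq_sum: "estimate \<phi> xs ys k = (\<Sum>j<k. upd \<phi> xs ys j)"
  by (induction k) simp_all

text \<open>Causality of the loop: the state at time \<open>k\<close> depends only on the updating
  functions of earlier times. This makes a recursive choice of updating functions possible.\<close>

lemma info_cong:
  assumes "\<And>j. j < k \<Longrightarrow> \<phi> j = \<psi> j"
  shows "estimate \<phi> xs ys k = estimate \<psi> xs ys k \<and> info \<phi> xs ys k = info \<psi> xs ys k"
  using assms
proof (induction k rule: less_induct)
  case (less k)
  have IH: "estimate \<phi> xs ys j = estimate \<psi> xs ys j" "info \<phi> xs ys j = info \<psi> xs ys j" if "j < k" for j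
    using less.IH[OF that] less.prems that by auto
  have upd: "upd \<phi> xs ys j = upd \<psi> xs ys j" if "j < k" for j
    using IH(2)[OF that] less.prems[OF that] by (simp add: upd.simps)
  have "estimate \<phi> xs ys k = estimate \<psi> xs ys k"
    unfolding estimate_eq_sum by (rule sum.cong) (use upd in auto)
  then have "estimate \<phi> xs ys j = estimate \<psi> xs ys j" if "j \<le> k" for j
    using IH(1)[of j] that by (cases "j = k") auto
  with upd show ?case
    by (auto simp: info.simps[of _ xs ys k] restrict_def fun_eq_iff)
qed

lemma update_eq_upd:
  "update \<phi> w x \<epsilon> k \<omega> = upd \<phi> (\<lambda>j. x j \<omega>) (\<lambda>j. outputs w x \<epsilon> j \<omega>) k"
  by (simp add: update_def information_def upd.simps)

lemma err_0: "err \<phi> w x \<epsilon> 0 \<omega> = - w \<omega>"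
  by (simp add: err_def)

lemma err_Suc: "err \<phi> w x \<epsilon> (Suc k) \<omega> = err \<phi> w x \<epsilon> k \<omega> + update \<phi> w x \<epsilon> k \<omega>"
  by (simp add: err_def update_eq_upd)

lemma err_eq_sum_update: "err \<phi> w x \<epsilon> k \<omega> = (\<Sum>j<k. update \<phi> w x \<epsilon> j \<omega>) - w \<omega>"
  by (simp add: err_def estimate_eq_sum update_eq_upd)

lemma information_eq: "information \<phi> w x \<epsilon> k \<omega> =
    (\<lambda>j\<in>{..k}. (x j \<omega>, (\<Sum>i<j. update \<phi> w x \<epsilon> i \<omega>) \<bullet> x j \<omega> - outputs w x \<epsilon> j \<omega>),
     \<lambda>j\<in>{..<k}. update \<phi> w x \<epsilon> j \<omega>)"
  by (simp add: information_def info.simps[of _ _ _ k] estimate_eq_sum update_eq_upd)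

section \<open>Measurable functions of the information\<close>

lemma measurable_info_input:
  assumes "j \<le> k" shows "(\<lambda>I. fst (fst I j)) \<in> borel_measurable (info_space k)"
proof -
  have "(\<lambda>I. fst I j) \<in> borel_measurable (info_space k)"
    unfolding info_space_def
    by (rule measurable_compose[OF measurable_fst measurable_component_singleton]) (use assms in simp)
  then show ?thesis by (rule measurable_compose) (simp add: borel_measurable_continuous_onI continuous_on_fst)
qed

lemma measurable_info_innovation:
  assumes "j \<le> k" shows "(\<lambda>I. snd (fst I j)) \<in> borel_measurable (info_space k)"
proof -
  have "(\<lambda>I. fst I j) \<in> borel_measurable (info_space k)"
    unfolding info_space_def
    by (rule measurable_compose[OF measurable_fst measurable_component_singleton]) (use assms in simp)
  then show ?thesis by (rule measurable_compose) (simp add: borel_measurable_continuous_onI continuous_on_snd)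
qed

lemma measurable_info_update:
  assumes "j < k" shows "(\<lambda>I. snd I j) \<in> borel_measurable (info_space k)"
  unfolding info_space_def
  by (rule measurable_compose[OF measurable_snd measurable_component_singleton]) (use assms in simp)

text \<open>The weight is estimated by \<open>Q\<close>-inverse applied to the average of \<open>y j\<close> times \<open>x j\<close>, where the
  output \<open>y j\<close> is recovered from the information as \<open>estimate j \<bullet> x j - (estimate j \<bullet> x j - y j)\<close>.\<close>

definition error_estimator :: "real^'d^'d \<Rightarrow> nat \<Rightarrow> ('d::finite) info \<Rightarrow> real^'d" where
  "error_estimator Q k I = (\<Sum>j<k. snd I j) - (1 / real (Suc k)) *\<^sub>R (matrix_inv Q *v
     (\<Sum>j<Suc k. ((\<Sum>i<j. snd I i) \<bullet> fst (fst I j) - snd (fst I j)) *\<^sub>R fst (fst I j)))"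

lemma measurable_error_estimator: "error_estimator Q k \<in> borel_measurable (info_space k)"
  unfolding error_estimator_def
  by (intro borel_measurable_diff borel_measurable_sum borel_measurable_scaleR borel_measurable_const
      measurable_matrix_vector_mult borel_measurable_inner measurable_info_update
      measurable_info_input measurable_info_innovation) auto

lemma outer_mult_vector: "outer a b *v e = (b \<bullet> e) *\<^sub>R a"
  by (simp add: outer_def matrix_vector_mult_def vec_eq_iff inner_vec_def sum_distrib_left mult_ac)

section \<open>Measurability and filtering error in the closed loop\<close>

context linear_data_model
begin

text \<open>Both claims need one induction: the information at \<open>k\<close> contains the earlier
  updates, and the update at \<open>k\<close> is a function of that information.\<close>

lemma update_information_measurable:
  assumes "updating_functions \<phi>"
  shows "update \<phi> w x \<epsilon> k \<in> borel_measurable M \<and> information \<phi> w x \<epsilon> k \<in> M \<rightarrow>\<^sub>M info_space k"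
proof (induction k rule: less_induct)
  case (less k)
  then have u: "update \<phi> w x \<epsilon> j \<in> borel_measurable M" if "j < k" for j
    using that by blast
  have "information \<phi> w x \<epsilon> k \<in> M \<rightarrow>\<^sub>M info_space k"
    unfolding information_eq[abs_def] info_space_def
  proof (intro measurable_Pair measurable_restrict)
    fix j assume "j \<in> {..k}"
    then show "(\<lambda>\<omega>. (x j \<omega>, (\<Sum>i<j. update \<phi> w x \<epsilon> i \<omega>) \<bullet> x j \<omega> - outputs w x \<epsilon> j \<omega>))
        \<in> borel_measurable M"
      by (intro borel_measurable_Pair borel_measurable_diff borel_measurable_inner
          borel_measurable_sum u input_measurable outputs_measurable) auto
  qed (use u in auto)
  moreover from this have "update \<phi> w x \<epsilon> k \<in> borel_measurable M"
    using assms unfolding update_def[abs_def] updating_functions_def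
    by (blast intro: measurable_compose)
  ultimately show ?case by simp
qed

lemmas update_measurable = update_information_measurable[THEN conjunct1]
  and information_measurable = update_information_measurable[THEN conjunct2]

lemma information_algebra_subalgebra:
  assumes "updating_functions \<phi>"
  shows "finite_measure_subalgebra M (information_algebra M \<phi> w x \<epsilon> k)"
proof
  have "information \<phi> w x \<epsilon> k \<in> space M \<rightarrow> space (info_space k)"
    using information_measurable[OF assms, of k] by (auto dest: measurable_space)
  then show "subalgebra M (information_algebra M \<phi> w x \<epsilon> k)"
    unfolding subalgebra_def information_algebra_def
    using measurable_sets[OF information_measurable[OF assms, of k]]
    by (auto simp: sets_vimage_algebra2)
qed

lemma information_algebra_measurable:
  assumes "updating_functions \<phi>" and "f \<in> info_space k \<rightarrow>\<^sub>M N"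
  shows "(\<lambda>\<omega>. f (information \<phi> w x \<epsilon> k \<omega>)) \<in> information_algebra M \<phi> w x \<epsilon> k \<rightarrow>\<^sub>M N"
proof (rule measurable_compose[OF _ assms(2)])
  show "information \<phi> w x \<epsilon> k \<in> information_algebra M \<phi> w x \<epsilon> k \<rightarrow>\<^sub>M info_space k"
    unfolding information_algebra_def using information_measurable[OF assms(1), of k]
    by (intro measurable_vimage_algebra1) (auto dest: measurable_space)
qed

text \<open>The current estimate cancels, so the right-hand side does not depend on
  \<open>\<phi>\<close>. At time \<open>k\<close> there are \<open>Suc k\<close> samples, since
  indexing starts at 0.\<close>

lemma err_minus_error_estimator:
  assumes "pos_def Q"
  shows "err \<phi> w x \<epsilon> k \<omega> - error_estimator Q k (information \<phi> w x \<epsilon> k \<omega>)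
    = (1 / real (Suc k)) *\<^sub>R (matrix_inv Q *v (\<Sum>j<Suc k. residual j \<omega>))"
proof -
  have inv: "matrix_inv Q *v (Q *v v) = v" for v
    using assms by (intro matrix_vector_mult_matrix_inv(2)) (simp add: pos_def_def)
  have est: "error_estimator Q k (information \<phi> w x \<epsilon> k \<omega>) = (\<Sum>j<k. update \<phi> w x \<epsilon> j \<omega>)
      - (1 / real (Suc k)) *\<^sub>R (matrix_inv Q *v (\<Sum>j<Suc k. outputs w x \<epsilon> j \<omega> *\<^sub>R x j \<omega>))"
    unfolding error_estimator_def information_eq by (simp del: sum.lessThan_Suc)
  have "(\<Sum>j<Suc k. residual j \<omega>) = (\<Sum>j<Suc k. outputs w x \<epsilon> j \<omega> *\<^sub>R x j \<omega>) - real (Suc k) *\<^sub>R (Q *v w \<omega>)"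
    unfolding residual_def sum_subtractf by (simp only: sum_constant_scaleR card_lessThan)
  then have "(1 / real (Suc k)) *\<^sub>R (matrix_inv Q *v (\<Sum>j<Suc k. residual j \<omega>))
      = (1 / real (Suc k)) *\<^sub>R (matrix_inv Q *v (\<Sum>j<Suc k. outputs w x \<epsilon> j \<omega> *\<^sub>R x j \<omega>)) - w \<omega>"
    by (simp add: matrix_vector_mult_diff_distrib matrix_vector_mult_scaleR inv scaleR_diff_right
        del: sum.lessThan_Suc of_nat_Suc)
  then show ?thesis unfolding est err_eq_sum_update by simp
qed

text \<open>The conditional expectation is at least as good as the explicit estimator. Its deviation
  is an average of \<open>Suc k\<close> residuals, whose mean square is a linear growth divided by a
  square. The constant serves all \<open>\<phi>\<close> and \<open>k\<close>.\<close>

lemma filtering_error_bound: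
  assumes "pos_def Q"
  obtains C where "\<And>\<phi> k. updating_functions \<phi> \<Longrightarrow> square_integrable M (err \<phi> w x \<epsilon> k) \<Longrightarrow>
    expectation (\<lambda>\<omega>. (norm (err \<phi> w x \<epsilon> k \<omega>
      - vec_cond_exp M (information_algebra M \<phi> w x \<epsilon> k) (err \<phi> w x \<epsilon> k) \<omega>))\<^sup>2) \<le> C / real (Suc k)"
proof -
  obtain c where c: "\<And>v. norm (matrix_inv Q *v v) \<le> c * norm v"
    using matrix_vector_mult_bound[of "matrix_inv Q"] by metis
  obtain C where C: "\<And>n. expectation (\<lambda>\<omega>. (norm (\<Sum>k<n. residual k \<omega>))\<^sup>2) \<le> real n * C"
    and sq_sum: "\<And>n. square_integrable M (\<lambda>\<omega>. \<Sum>k<n. residual k \<omega>)"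
    using residual_sum_bound by metis
  show ?thesis
  proof (rule that[of "c\<^sup>2 * C"])
    fix \<phi> :: "'d updating" and k
    assume \<phi>: "updating_functions \<phi>" and err: "square_integrable M (err \<phi> w x \<epsilon> k)"
    define h where "h \<omega> = error_estimator Q k (information \<phi> w x \<epsilon> k \<omega>)" for \<omega>
    define S where "S \<omega> = (\<Sum>j<Suc k. residual j \<omega>)" for \<omega>
    define n where "n = real (Suc k)"
    interpret finite_measure_subalgebra M "information_algebra M \<phi> w x \<epsilon> k"
      by (rule information_algebra_subalgebra[OF \<phi>])
    have diff: "err \<phi> w x \<epsilon> k \<omega> - h \<omega> = (1 / n) *\<^sub>R (matrix_inv Q *v S \<omega>)" for \<omega>
      unfolding h_def S_def n_def by (rule err_minus_error_estimator[OF assms])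
    have S: "square_integrable M S"
      unfolding S_def by (rule sq_sum)
    have sq_diff: "square_integrable M (\<lambda>\<omega>. err \<phi> w x \<epsilon> k \<omega> - h \<omega>)"
      unfolding diff matrix_vector_mult_scaleR[symmetric]
      using S by (intro square_integrable_matrix_vector_mult)
        (rule square_integrable_bound[OF S, where C = "1 / n"],
         auto simp: square_integrable_def n_def)
    \<comment> \<open>Obtained as the difference of the error and the deviation already controlled
      by residuals.\<close>
    have h: "square_integrable M h"
      using square_integrable_diff[OF err sq_diff] by simp
    have h_measurable: "h \<in> borel_measurable (information_algebra M \<phi> w x \<epsilon> k)"
      unfolding h_def by (rule information_algebra_measurable[OF \<phi> measurable_error_estimator])
    have "expectation (\<lambda>\<omega>. (norm (err \<phi> w x \<epsilon> k \<omega>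
        - vec_cond_exp M (information_algebra M \<phi> w x \<epsilon> k) (err \<phi> w x \<epsilon> k) \<omega>))\<^sup>2)
      \<le> expectation (\<lambda>\<omega>. (norm (err \<phi> w x \<epsilon> k \<omega> - h \<omega>))\<^sup>2)"
      by (rule vec_cond_exp_best_approximation[OF err h h_measurable])
    also have "\<dots> \<le> expectation (\<lambda>\<omega>. (c / n)\<^sup>2 * (norm (S \<omega>))\<^sup>2)"
    proof (rule integral_mono)
      fix \<omega>
      have "norm (err \<phi> w x \<epsilon> k \<omega> - h \<omega>) \<le> c / n * norm (S \<omega>)"
        unfolding diff using c[of "S \<omega>"] by (simp add: n_def divide_right_mono)
      then have "(norm (err \<phi> w x \<epsilon> k \<omega> - h \<omega>))\<^sup>2 \<le> (c / n * norm (S \<omega>))\<^sup>2"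
        by (rule power_mono) simp
      then show "(norm (err \<phi> w x \<epsilon> k \<omega> - h \<omega>))\<^sup>2 \<le> (c / n)\<^sup>2 * (norm (S \<omega>))\<^sup>2"
        by (simp only: power_mult_distrib)
    qed (use S sq_diff in \<open>auto simp: square_integrable_def\<close>)
    also have "\<dots> = (c / n)\<^sup>2 * expectation (\<lambda>\<omega>. (norm (S \<omega>))\<^sup>2)"
      by simp
    also have "\<dots> \<le> (c / n)\<^sup>2 * (n * C)"
      unfolding S_def n_def by (intro mult_left_mono C) simp
    also have "\<dots> = c\<^sup>2 * C / n"
      by (simp add: power2_eq_square)
    finally show "expectation (\<lambda>\<omega>. (norm (err \<phi> w x \<epsilon> k \<omega>
        - vec_cond_exp M (information_algebra M \<phi> w x \<epsilon> k) (err \<phi> w x \<epsilon> k) \<omega>))\<^sup>2)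
      \<le> c\<^sup>2 * C / real (Suc k)" unfolding n_def .
  qed
qed

end

text \<open>\<open>harm n - ln n\<close> converges to the Euler-Mascheroni constant, and
  \<open>ln n / n\<close> tends to 0.\<close>

lemma harm_over_n_tendsto_0: "(\<lambda>n. harm n / real n) \<longlonglongrightarrow> 0"
proof -
  have "(\<lambda>n. (harm n - ln (real n)) * (1 / real n) + ln (real n) / real n)
      \<longlonglongrightarrow> euler_mascheroni * 0 + 0"
    by (intro tendsto_add tendsto_mult euler_mascheroni_LIMSEQ lim_1_over_n lim_ln_over_n)
  then show ?thesis by (simp add: diff_divide_distrib)
qed

lemma sum_inverse_Suc_eq_harm: "(\<Sum>k<n. C / real (Suc k)) = C * harm n"
  by (induction n) (simp_all add: harm_Suc harm_def[of 0] divide_inverse distrib_left)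

section \<open>Existence and average cost of the feedback law\<close>

context linear_data_model
begin

text \<open>The feedback law mentions \<open>\<phi>\<close> on both sides, but by causality its
  right-hand side at time \<open>k\<close> involves only earlier updating functions. Well-founded
  recursion therefore resolves the apparent circularity.\<close>

lemma cond_exp_feedback_exists:
  "\<exists>\<phi>. updating_functions \<phi> \<and> cond_exp_feedback M w x \<epsilon> L \<phi>"
proof -
  \<comment> \<open>Equality is required at every point for the version fixed by
    \<open>real_cond_exp\<close>, so no exceptional null sets enter the recursion.\<close>
  define P where "P \<phi> k r \<longleftrightarrow> r \<in> borel_measurable (info_space k) \<and>
    (\<forall>\<omega>\<in>space M. r (information \<phi> w x \<epsilon> k \<omega>) =
      L *v vec_cond_exp M (information_algebra M \<phi> w x \<epsilon> k) (err \<phi> w x \<epsilon> k) \<omega>)"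
    for \<phi> :: "'d updating" and k r
  have "\<exists>\<phi>. \<forall>k. P \<phi> k (\<phi> k)"
  proof (rule dependent_wf_choice[OF wf_less])
    fix \<phi> \<psi> :: "'d updating" and k r
    assume "\<And>j. (j, k) \<in> {(x, y). x < y} \<Longrightarrow> \<phi> j = \<psi> j"
    then have eq: "\<phi> j = \<psi> j" if "j < k" for j using that by blast
    have "information \<phi> w x \<epsilon> k = information \<psi> w x \<epsilon> k" "err \<phi> w x \<epsilon> k = err \<psi> w x \<epsilon> k"
      using info_cong[of k \<phi> \<psi>] eq by (simp_all add: fun_eq_iff information_def err_def)
    with eq show "P \<phi> k r = P \<psi> k r"
      by (simp add: P_def information_algebra_def)
  next
    fix k and \<phi> :: "'d updating"
    assume "\<And>j. (j, k) \<in> {(x, y). x < y} \<Longrightarrow> P \<phi> j (\<phi> j)"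
    then have meas: "\<phi> j \<in> borel_measurable (info_space j)" if "j < k" for j
      using that by (simp add: P_def)
    \<comment> \<open>The recursion provides measurability only below \<open>k\<close>. Replacing
      the later functions by 0 gives a fully admissible family with the same information at time
      \<open>k\<close>.\<close>
    define \<psi> where "\<psi> j = (if j < k then \<phi> j else (\<lambda>_. 0))" for j
    have \<psi>: "updating_functions \<psi>"
      using meas by (simp add: updating_functions_def \<psi>_def)
    have info: "information \<phi> w x \<epsilon> k = information \<psi> w x \<epsilon> k"
      using info_cong[of k \<phi> \<psi>] by (simp add: fun_eq_iff information_def \<psi>_def)
    have range: "information \<phi> w x \<epsilon> k \<in> space M \<rightarrow> space (info_space k)"
      unfolding info using information_measurable[OF \<psi>, of k] by (auto dest: measurable_space)
    have cond_exp: "(\<lambda>\<omega>. L *v vec_cond_exp M (information_algebra M \<phi> w x \<epsilon> k) (err \<phi> w x \<epsilon> k) \<omega>)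
        \<in> borel_measurable (vimage_algebra (space M) (information \<phi> w x \<epsilon> k) (info_space k))"
      unfolding information_algebra_def[symmetric]
      by (intro measurable_matrix_vector_mult borel_measurable_vecI)
         (simp add: vec_cond_exp_def borel_measurable_cond_exp)
    obtain g where "g \<in> borel_measurable (info_space k)"
      "\<And>\<omega>. \<omega> \<in> space M \<Longrightarrow>
        L *v vec_cond_exp M (information_algebra M \<phi> w x \<epsilon> k) (err \<phi> w x \<epsilon> k) \<omega>
        = g (information \<phi> w x \<epsilon> k \<omega>)"
      using vec_factorization_vimage_algebra[OF cond_exp range] by blast
    then show "\<exists>r. P \<phi> k r" by (intro exI[of _ g]) (simp add: P_def)
  qed
  then obtain \<phi> where P: "\<And>k. P \<phi> k (\<phi> k)" by blast
  then have meas: "\<phi> k \<in> borel_measurable (info_space k)" for k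
    by (simp add: P_def)
  with P have "\<forall>\<omega>\<in>space M. \<phi> k (information \<phi> w x \<epsilon> k \<omega>) =
      L *v vec_cond_exp M (information_algebra M \<phi> w x \<epsilon> k) (err \<phi> w x \<epsilon> k) \<omega>" for k
    by (simp add: P_def)
  with meas show ?thesis
    unfolding updating_functions_def cond_exp_feedback_def by (blast intro: AE_I2)
qed

text \<open>Conditional expectation and multiplication by \<open>L\<close> preserve square
  integrability, so it propagates from the initial error \<open>- w\<close>.\<close>

lemma err_square_integrable:
  assumes \<phi>: "updating_functions \<phi>" and feedback: "cond_exp_feedback M w x \<epsilon> L \<phi>"
  shows "square_integrable M (err \<phi> w x \<epsilon> k)"
proof (induction k)
  case 0
  show ?case
    unfolding err_0[abs_def] by (rule square_integrable_uminus[OF weight_square_integrable])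
next
  case (Suc k)
  interpret finite_measure_subalgebra M "information_algebra M \<phi> w x \<epsilon> k"
    by (rule information_algebra_subalgebra[OF \<phi>])
  have "square_integrable M
      (\<lambda>\<omega>. L *v vec_cond_exp M (information_algebra M \<phi> w x \<epsilon> k) (err \<phi> w x \<epsilon> k) \<omega>)"
    by (intro square_integrable_matrix_vector_mult square_integrable_vec_cond_exp Suc)
  then have "square_integrable M (update \<phi> w x \<epsilon> k)"
  proof (rule square_integrable_bound[where C = 1])
    show "AE \<omega> in M. norm (update \<phi> w x \<epsilon> k \<omega>) \<le> 1 * norm
        (L *v vec_cond_exp M (information_algebra M \<phi> w x \<epsilon> k) (err \<phi> w x \<epsilon> k) \<omega>)"
      using feedback[unfolded cond_exp_feedback_def, rule_format, of k]
      by eventually_elim (simp add: update_def)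
  qed (rule update_measurable[OF \<phi>])
  then show ?case
    unfolding err_Suc[abs_def] by (rule square_integrable_add[OF Suc])
qed

text \<open>After telescoping, only the initial mean of \<open>e \<bullet> (K *v e)\<close> and a
  multiple of \<open>harm N\<close> bound the total cost; both are negligible against
  \<open>N\<close>. The averages in fact converge, which settles the \<open>liminf\<close>.\<close>

lemma learning_functional_eq_0:
  assumes "\<gamma> > 0" "pos_def Q" and riccati: "stationary_riccati \<gamma> Q K"
    and \<phi>: "updating_functions \<phi>" and feedback: "cond_exp_feedback M w x \<epsilon> (gain \<gamma> K) \<phi>"
  shows "learning_functional M w x \<epsilon> \<gamma> \<phi> = 0"
proof -
  define e where "e = err \<phi> w x \<epsilon>"
  define u where "u = update \<phi> w x \<epsilon>"
  define e\<^sub>c where "e\<^sub>c k = vec_cond_exp M (information_algebra M \<phi> w x \<epsilon> k) (e k)" for k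
  define V where "V k \<omega> = e k \<omega> \<bullet> (K *v e k \<omega>)" for k \<omega>
  define stage where "stage k \<omega> = e k \<omega> \<bullet> (Q *v e k \<omega>) + \<gamma> * (u k \<omega> \<bullet> u k \<omega>)" for k \<omega>
  define cost where
    "cost k \<omega> = e k \<omega> \<bullet> (outer (x k \<omega>) (x k \<omega>) *v e k \<omega>) + \<gamma> * (u k \<omega> \<bullet> u k \<omega>)" for k \<omega>
  define gap where "gap k \<omega> = (norm (e k \<omega> - e\<^sub>c k \<omega>))\<^sup>2" for k \<omega>
  have e_Suc: "e (Suc k) \<omega> = e k \<omega> + u k \<omega>" for k \<omega>
    by (simp add: e_def u_def err_Suc)
  have e_sq: "square_integrable M (e k)" for k
    unfolding e_def by (rule err_square_integrable[OF \<phi> feedback])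
  have u_sq: "square_integrable M (u k)" for k
    using square_integrable_diff[OF e_sq[of "Suc k"] e_sq[of k]] by (simp add: e_Suc)
  have gap_int: "integrable M (gap k)" for k
  proof -
    interpret finite_measure_subalgebra M "information_algebra M \<phi> w x \<epsilon> k"
      by (rule information_algebra_subalgebra[OF \<phi>])
    show ?thesis
      unfolding gap_def e\<^sub>c_def
      by (intro square_integrable_norm square_integrable_diff square_integrable_vec_cond_exp e_sq)
  qed
  have V_int: "integrable M (V k)" for k
    unfolding V_def
    by (intro integrable_inner_square_integrable square_integrable_matrix_vector_mult e_sq)
  have stage_int: "integrable M (stage k)" for k
    unfolding stage_def
    by (intro Bochner_Integration.integrable_add integrable_mult_right
        integrable_inner_square_integrable square_integrable_matrix_vector_mult e_sq u_sq)

  obtain C where C: "\<And>k. expectation (gap k) \<le> C / real (Suc k)"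
  proof (rule filtering_error_bound[OF \<open>pos_def Q\<close>], goal_cases)
    case (1 C)
    show ?case
      by (rule 1(1)[of C], unfold gap_def e\<^sub>c_def e_def) (rule 1(2)[OF \<phi> e_sq[unfolded e_def]])
  qed
  define A where "A = K + \<gamma> *\<^sub>R mat 1"
  define L where "L = gain \<gamma> K"
  obtain a where "a \<ge> 0" and a: "\<And>v. norm (A *v v) \<le> a * norm v"
    using matrix_vector_mult_bound[of A] by metis
  obtain l where "l \<ge> 0" and l: "\<And>v. norm (L *v v) \<le> l * norm v"
    using matrix_vector_mult_bound[of L] by metis
  \<comment> \<open>\<open>a\<close> bounds the quadratic form of \<open>A\<close>, and
    \<open>l\<close> bounds \<open>L\<close> acting on the filtering error, where it enters
    squared.\<close>
  define R where "R = a * l\<^sup>2"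
  have "R \<ge> 0" using \<open>a \<ge> 0\<close> by (simp add: R_def)
  have stage_le: "AE \<omega> in M. stage k \<omega> \<le> V k \<omega> - V (Suc k) \<omega> + R * gap k \<omega>" for k
    using feedback[unfolded cond_exp_feedback_def, rule_format, of k]
  proof eventually_elim
    case (elim \<omega>)
    then have "u k \<omega> = L *v e\<^sub>c k \<omega>"
      by (simp add: u_def update_def L_def e\<^sub>c_def e_def)
    then have d: "u k \<omega> - L *v e k \<omega> = L *v (e\<^sub>c k \<omega> - e k \<omega>)"
      by (simp add: matrix_vector_mult_diff_distrib)
    have quadratic: "v \<bullet> (A *v v) \<le> a * (norm v)\<^sup>2" for v
    proof -
      have "v \<bullet> (A *v v) \<le> norm v * norm (A *v v)" by (rule norm_cauchy_schwarz)
      also have "\<dots> \<le> norm v * (a * norm v)" by (intro mult_left_mono a) simp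
      finally show ?thesis by (simp add: power2_eq_square mult_ac)
    qed
    have "stage k \<omega> = V k \<omega> - V (Suc k) \<omega> + (u k \<omega> - L *v e k \<omega>) \<bullet> (A *v (u k \<omega> - L *v e k \<omega>))"
      unfolding stage_def V_def e_Suc A_def L_def
      by (rule riccati_completion_of_squares[OF \<open>\<gamma> > 0\<close> riccati])
    also have "(u k \<omega> - L *v e k \<omega>) \<bullet> (A *v (u k \<omega> - L *v e k \<omega>)) \<le> a * (norm (L *v (e\<^sub>c k \<omega> - e k \<omega>)))\<^sup>2"
      unfolding d by (rule quadratic)
    also have "\<dots> \<le> a * (l * norm (e\<^sub>c k \<omega> - e k \<omega>))\<^sup>2"
      using \<open>a \<ge> 0\<close> by (intro mult_left_mono power_mono l) auto
    also have "\<dots> = R * gap k \<omega>"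
      by (simp add: R_def gap_def power_mult_distrib norm_minus_commute)
    finally show ?case by simp
  qed

  have stage_sum: "expectation (\<lambda>\<omega>. \<Sum>k<N. stage k \<omega>) \<le> expectation (V 0) + R * C * harm N" for N
  proof -
    have V_nonneg: "V N \<omega> \<ge> 0" for \<omega>
      using riccati by (simp add: V_def stationary_riccati_def pos_semidef_def)
    have "expectation (\<lambda>\<omega>. \<Sum>k<N. stage k \<omega>) = (\<Sum>k<N. expectation (stage k))"
      by (intro Bochner_Integration.integral_sum stage_int)
    also have "\<dots> \<le> (\<Sum>k<N. expectation (V k) - expectation (V (Suc k)) + R * (C / real (Suc k)))"
    proof (rule sum_mono)
      fix k
      have "expectation (stage k) \<le> expectation (\<lambda>\<omega>. V k \<omega> - V (Suc k) \<omega> + R * gap k \<omega>)"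
        by (intro integral_mono_AE stage_int stage_le Bochner_Integration.integrable_add
            Bochner_Integration.integrable_diff integrable_mult_right V_int gap_int)
      also have "\<dots> = expectation (V k) - expectation (V (Suc k)) + R * expectation (gap k)"
        by (simp add: V_int gap_int)
      also have "R * expectation (gap k) \<le> R * (C / real (Suc k))"
        using C \<open>R \<ge> 0\<close> by (rule mult_left_mono)
      finally show "expectation (stage k)
          \<le> expectation (V k) - expectation (V (Suc k)) + R * (C / real (Suc k))" by simp
    qed
    \<comment> \<open>The differences telescope, and the filtering bounds add up to a harmonic
      number. The terminal term is then dropped because \<open>V N\<close> is nonnegative.\<close>
    also have "\<dots> = (expectation (V 0) - expectation (V N)) + R * (C * harm N)"
      by (simp only: sum.distrib sum_lessThan_telescope'[of "\<lambda>k. expectation (V k)"]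
          sum_distrib_left[symmetric] sum_inverse_Suc_eq_harm)
    also have "\<dots> \<le> expectation (V 0) + R * C * harm N"
      using Bochner_Integration.integral_nonneg[of M "V N"] V_nonneg by simp
    finally show ?thesis .
  qed

  obtain q where "q > 0" and q: "\<And>v. q * (norm v)\<^sup>2 \<le> v \<bullet> (Q *v v)"
    using pos_def_lower_bound[OF \<open>pos_def Q\<close>] by metis
  have Q_nonneg: "0 \<le> v \<bullet> (Q *v v)" for v
    by (rule order_trans[OF _ q]) (use \<open>q > 0\<close> in simp)
  \<comment> \<open>By boundedness of the input and the lower bound \<open>q\<close>, the factor
    \<open>B\<^sup>2 / q\<close> compares the square of \<open>x k \<bullet> e k\<close> with
    \<open>e k \<bullet> (Q *v e k)\<close> pointwise; the summand 1 accounts for the update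
    penalty.\<close>
  define D where "D = 1 + B\<^sup>2 / q"
  have "D \<ge> 0" using \<open>q > 0\<close> by (simp add: D_def)
  have cost_le: "AE \<omega> in M. cost k \<omega> \<le> D * stage k \<omega>" for k
    using input_bounded[of k]
  proof eventually_elim
    case (elim \<omega>)
    have "\<bar>x k \<omega> \<bullet> e k \<omega>\<bar> \<le> B * norm (e k \<omega>)"
      by (rule order_trans[OF Cauchy_Schwarz_ineq2]) (use elim in \<open>simp add: mult_right_mono\<close>)
    then have "\<bar>x k \<omega> \<bullet> e k \<omega>\<bar>\<^sup>2 \<le> (B * norm (e k \<omega>))\<^sup>2" by (rule power_mono) simp
    then have "e k \<omega> \<bullet> (outer (x k \<omega>) (x k \<omega>) *v e k \<omega>) \<le> B\<^sup>2 / q * (q * (norm (e k \<omega>))\<^sup>2)"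
      using \<open>q > 0\<close> by (simp add: outer_mult_vector inner_commute power2_eq_square mult_ac)
    also have "\<dots> \<le> B\<^sup>2 / q * (e k \<omega> \<bullet> (Q *v e k \<omega>))"
      using \<open>q > 0\<close> by (intro mult_left_mono q) simp
    finally have "e k \<omega> \<bullet> (outer (x k \<omega>) (x k \<omega>) *v e k \<omega>) \<le> B\<^sup>2 / q * (e k \<omega> \<bullet> (Q *v e k \<omega>))" .
    moreover have "0 \<le> e k \<omega> \<bullet> (Q *v e k \<omega>)" by (rule Q_nonneg)
    moreover have "0 \<le> B\<^sup>2 / q * (\<gamma> * (u k \<omega> \<bullet> u k \<omega>))"
      using \<open>q > 0\<close> \<open>\<gamma> > 0\<close> by simp
    ultimately show ?case
      unfolding cost_def stage_def D_def distrib_right distrib_left mult_1_left by linarith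
  qed

  have stage_nonneg: "0 \<le> stage k \<omega>" for k \<omega>
    using Q_nonneg \<open>\<gamma> > 0\<close> by (simp add: stage_def)
  \<comment> \<open>The case \<open>N = 0\<close> is included: \<open>1 / real 0\<close> is 0, so
    both sides vanish.\<close>
  have average_le: "ennreal (1 / real N) * (\<integral>\<^sup>+ \<omega>. ennreal (\<Sum>k<N. cost k \<omega>) \<partial>M)
      \<le> ennreal (D * (expectation (V 0) * (1 / real N) + R * C * (harm N / real N)))" for N
  proof -
    \<comment> \<open>One null set for all \<open>k\<close>, so that the pointwise bounds may be
      summed.\<close>
    have all: "AE \<omega> in M. \<forall>k. cost k \<omega> \<le> D * stage k \<omega>"
      unfolding AE_all_countable using cost_le by blast
    have "(\<integral>\<^sup>+ \<omega>. ennreal (\<Sum>k<N. cost k \<omega>) \<partial>M) \<le> (\<integral>\<^sup>+ \<omega>. ennreal (D * (\<Sum>k<N. stage k \<omega>)) \<partial>M)"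
      using all by (intro nn_integral_mono_AE, eventually_elim)
        (auto intro!: ennreal_leI sum_mono simp: sum_distrib_left)
    also have "\<dots> = ennreal (expectation (\<lambda>\<omega>. D * (\<Sum>k<N. stage k \<omega>)))"
      using \<open>D \<ge> 0\<close> stage_nonneg
      by (intro nn_integral_eq_integral integrable_mult_right Bochner_Integration.integrable_sum stage_int)
         (simp add: sum_nonneg)
    also have "\<dots> = ennreal (D * expectation (\<lambda>\<omega>. \<Sum>k<N. stage k \<omega>))"
      by simp
    also have "\<dots> \<le> ennreal (D * (expectation (V 0) + R * C * harm N))"
      using \<open>D \<ge> 0\<close> stage_sum by (intro ennreal_leI mult_left_mono)
    finally have "ennreal (1 / real N) * (\<integral>\<^sup>+ \<omega>. ennreal (\<Sum>k<N. cost k \<omega>) \<partial>M)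
        \<le> ennreal (1 / real N) * ennreal (D * (expectation (V 0) + R * C * harm N))"
      by (rule mult_left_mono) simp
    also have "\<dots> = ennreal (1 / real N * (D * (expectation (V 0) + R * C * harm N)))"
      by (rule ennreal_mult'[symmetric]) simp
    also have "1 / real N * (D * (expectation (V 0) + R * C * harm N))
        = D * (expectation (V 0) * (1 / real N) + R * C * (harm N / real N))"
      by (simp add: add_divide_distrib distrib_left)
    finally show ?thesis .
  qed
  have "(\<lambda>N. D * (expectation (V 0) * (1 / real N) + R * C * (harm N / real N)))
      \<longlonglongrightarrow> D * (expectation (V 0) * 0 + R * C * 0)"
    by (intro tendsto_mult tendsto_add tendsto_const lim_1_over_n harm_over_n_tendsto_0)
  then have "(\<lambda>N. ennreal (D * (expectation (V 0) * (1 / real N) + R * C * (harm N / real N))))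
      \<longlonglongrightarrow> ennreal 0"
    by (rule tendsto_ennrealI[OF tendsto_eq_rhs]) simp
  then have upper: "(\<lambda>N. ennreal (D * (expectation (V 0) * (1 / real N) + R * C * (harm N / real N))))
      \<longlonglongrightarrow> 0" by simp
  have "(\<lambda>N. ennreal (1 / real N) * (\<integral>\<^sup>+ \<omega>. ennreal (\<Sum>k<N. cost k \<omega>) \<partial>M)) \<longlonglongrightarrow> 0"
    by (rule tendsto_sandwich[OF _ _ tendsto_const upper]) (simp_all only: average_le zero_le eventually_True)
  then show ?thesis
    unfolding learning_functional_def cost_def e_def u_def
    by (intro lim_imp_Liminf trivial_limit_sequentially)
qed

end

section \<open>Optimality under the assumptions of the data model\<close>

theorem proposition4:
  fixes M :: "'a measure"
    and w :: "'a \<Rightarrow> real^'d" and x :: "nat \<Rightarrow> 'a \<Rightarrow> real^'d" and \<epsilon> :: "nat \<Rightarrow> 'a \<Rightarrow> real"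
    and \<Sigma>\<^sub>w Q K :: "real^'d^'d" and \<sigma> \<gamma> :: real
  assumes "prob_space M"
    and "\<gamma> > 0"
    and "w \<in> borel_measurable M"
    and "\<And>k. x k \<in> borel_measurable M"
    and "\<And>k. \<epsilon> k \<in> borel_measurable M"
    and "mutually_independent M w x \<epsilon>"
    and "gaussian M w"
    and "(LINT \<omega>|M. w \<omega>) = 0"
    and "covariance_matrix M w = \<Sigma>\<^sub>w"
    and "\<And>k. gaussian M (\<epsilon> k)"
    and "\<And>k. (LINT \<omega>|M. \<epsilon> k \<omega>) = 0"
    and "\<sigma> > 0"
    and "\<And>k. (LINT \<omega>|M. (\<epsilon> k \<omega>)\<^sup>2) = \<sigma>\<^sup>2"
    and "\<And>k. distr M borel (x k) = distr M borel (x 0)"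
    and "\<exists>S. bounded S \<and> (\<forall>k. AE \<omega> in M. x k \<omega> \<in> S)"
    and "\<And>k. (LINT \<omega>|M. x k \<omega>) = 0"
    and "\<And>k. (LINT \<omega>|M. outer (x k \<omega>) (x k \<omega>)) = Q"
    and "pos_def Q"
    and "stationary_riccati \<gamma> Q K"
  shows "(\<exists>\<phi>. updating_functions \<phi> \<and> cond_exp_feedback M w x \<epsilon> (gain \<gamma> K) \<phi>)
    \<and> (\<forall>\<phi>. updating_functions \<phi> \<and> cond_exp_feedback M w x \<epsilon> (gain \<gamma> K) \<phi>
          \<longrightarrow> is_arg_min (learning_functional M w x \<epsilon> \<gamma>) updating_functions \<phi>)"
proof -
  obtain S where S: "bounded S" "\<And>k. AE \<omega> in M. x k \<omega> \<in> S"
    using assms(15) by blast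
  obtain B where "\<And>v. v \<in> S \<Longrightarrow> norm v \<le> B"
    using \<open>bounded S\<close> by (auto simp: bounded_iff)
  then have input_bounded: "AE \<omega> in M. norm (x k \<omega>) \<le> B" for k
    using S(2)[of k] by (auto elim!: eventually_mono)
  \<comment> \<open>A unit vector exists, so positive definiteness excludes
    \<open>Q = 0\<close>.\<close>
  obtain v :: "real^'d" where "norm v = 1"
    using vector_choose_size[of 1] by auto
  then have "v \<noteq> 0" by auto
  with \<open>pos_def Q\<close> have "Q *v v \<noteq> 0" by (force simp: pos_def_def)
  then have "Q \<noteq> 0" by auto
  text \<open>A non-integrable second moment would have the junk value 0, contradicting \<open>Q \<noteq> 0\<close>;
    likewise for the noise variance.\<close>
  then have outer_int: "integrable M (\<lambda>\<omega>. outer (x k \<omega>) (x k \<omega>))" for k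
    using assms(17)[of k] not_integrable_integral_eq by force
  have second_moment: "(LINT \<omega>|M. x k \<omega> $ a * x k \<omega> $ b) = Q $ a $ b" for k a b
  proof -
    have "bounded_linear (\<lambda>A :: real^'d^'d. A $ a $ b)"
      by (intro bounded_linear_compose[OF bounded_linear_vec_nth bounded_linear_vec_nth])
    from integral_bounded_linear[OF this outer_int[of k]] show ?thesis
      by (simp add: assms(17)) (simp add: outer_def)
  qed
  have "integrable M (\<lambda>\<omega>. (\<epsilon> k \<omega>)\<^sup>2)" for k
    using assms(13)[of k] \<open>\<sigma> > 0\<close> not_integrable_integral_eq by force
  then have noise: "square_integrable M (\<epsilon> k)" for k
    using assms(5) by (simp add: square_integrable_def)
  interpret prob_space M by fact
  interpret linear_data_model M w x \<epsilon> Q \<sigma> B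
    by unfold_locales
       (rule gaussian_square_integrable assms noise second_moment input_bounded)+
  show ?thesis
    \<comment> \<open>The value 0 is the least element of \<open>ennreal\<close>, so no competitor
      can be strictly better.\<close>
    using cond_exp_feedback_exists learning_functional_eq_0[OF assms(2,18,19)]
    by (auto simp: is_arg_min_def)
qed

end
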